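(* Let $(\mathcal M,\mathcal H_\mu)$ and $(\mathcal N,\mathcal H_\nu)$ be $\mathbb Z_2$-graded von Neumann algebras with cyclic vectors $\xi_\mu,\xi_\nu$ and even vector states $\mu,\nu$ (setting and notation as in the context). For any positive linear map $\Psi:\mathcal M\to\mathcal N$ such that $\nu\circ\Psi=\mu$, there exists a unique unital map $\Psi^{\wr}:\mathcal N^{\wr}\to\mathcal M^{\wr}$ satisfying $$\langle\Psi^{\wr}(b^{\wr})a\xi_\mu,\xi_\mu\rangle=\langle b^{\wr}\Psi(a)\xi_\nu,\xi_\nu\rangle$$ for all $a\in\mathcal M$ and $b^{\wr}\in\mathcal N^{\wr}$. In addition, if $\Psi$ is unit preserving, then $\mu^{\wr}\circ\Psi^{\wr}=\nu^{\wr}$, and $\Psi^{\wr}$ is faithful.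
   Context: $(\mathcal M,\mathcal H_\mu)$ and $(\mathcal N,\mathcal H_\nu)$ are von Neumann algebras acting on the indicated Hilbert spaces, with cyclic (unit) vectors $\xi_\mu$, $\xi_\nu$, and states $\mu(a)=\langle a\xi_\mu,\xi_\mu\rangle$ on $\mathcal M$, $\nu(b)=\langle b\xi_\nu,\xi_\nu\rangle$ on $\mathcal N$. They carry $\mathbb Z_2$-gradings, i.e. $*$-automorphisms $\theta_\mu$, $\theta_\nu$ with $\theta_\mu^2=\mathrm{id}$, $\theta_\nu^2=\mathrm{id}$, and $\mu,\nu$ are even: $\mu\circ\theta_\mu=\mu$, $\nu\circ\theta_\nu=\nu$. $\Gamma_\mu$ is the self-adjoint unitary on $\mathcal H_\mu$ determined by $\Gamma_\mu a\xi_\mu=\theta_\mu(a)\xi_\mu$ ($a\in\mathcal M$), and similarly $\Gamma_\nu$. For a self-adjoint unitary $\Gamma$ on $\mathcal H$, each $a\in\mathcal B(\mathcal H)$ is uniquely $a=a_++a_-$ with $\Gamma a_\pm\Gamma=\pm a_\pm$; put $\kappa_\Gamma(a)=a_++\Gamma a_-$. The twisted commutants are $\mathcal M^{\wr}=\kappa_{\Gamma_\mu}(\mathcal M')$ and $\mathcal N^{\wr}=\kappa_{\Gamma_\nu}(\mathcal N')$ (von Neumann algebras). $\mu^{\wr}$ and $\nu^{\wr}$ are the restrictions to $\mathcal M^{\wr}$, $\mathcal N^{\wr}$ of $\langle\,\cdot\,\xi_\mu,\xi_\mu\rangle$, $\langle\,\cdot\,\xi_\nu,\xi_\nu\rangle$.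 A map $T$ is faithful if $T(x^*x)=0$ implies $x=0$. *)

theory Defs
  imports "HOL-Analysis.Analysis"
begin

text \<open>
  Complex Hilbert spaces of arbitrary dimension. The inner product is linear in the \<^emph>\<open>first\<close>
  variable; its real part is the inner product of the underlying real Hilbert space, so that norm
  and topology are those of the library.
\<close>

class complex_hilbert = real_inner + complete_space +
  fixes scaleC :: "complex \<Rightarrow> 'a \<Rightarrow> 'a"  (infixr "*\<^sub>C" 75)
    and cinner :: "'a \<Rightarrow> 'a \<Rightarrow> complex"
  assumes scaleC_add_right: "c *\<^sub>C (x + y) = c *\<^sub>C x + c *\<^sub>C y"
    and scaleC_add_left: "(c + d) *\<^sub>C x = c *\<^sub>C x + d *\<^sub>C x"
    and scaleC_scaleC: "c *\<^sub>C (d *\<^sub>C x) = (c * d) *\<^sub>C x"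
    and scaleC_of_real: "complex_of_real r *\<^sub>C x = r *\<^sub>R x"
    and cinner_commute: "cinner x y = cnj (cinner y x)"
    and cinner_add_left: "cinner (x + y) z = cinner x z + cinner y z"
    and cinner_scaleC_left: "cinner (c *\<^sub>C x) y = c * cinner x y"
    and Re_cinner: "Re (cinner x y) = x \<bullet> y"

instantiation complex :: complex_hilbert
begin

definition scaleC_complex :: "complex \<Rightarrow> complex \<Rightarrow> complex"
  where "scaleC_complex c x = c * x"

definition cinner_complex :: "complex \<Rightarrow> complex \<Rightarrow> complex"
  where "cinner_complex x y = x * cnj y"

instance
  by standard
    (auto simp: scaleC_complex_def cinner_complex_def algebra_simps scaleR_conv_of_real
      inner_complex_def)

end

text \<open>
  Elements of B(H) are functions satisfying \<^term>\<open>bounded_clinear\<close>; the product is composition,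
  the unit is \<^term>\<open>id\<close>, and sums and scalar multiples are taken pointwise.
\<close>

definition bounded_clinear :: "('h::complex_hilbert \<Rightarrow> 'h) \<Rightarrow> bool"
  where "bounded_clinear a \<longleftrightarrow> bounded_linear a \<and> (\<forall>c x. a (c *\<^sub>C x) = c *\<^sub>C a x)"

definition cadjoint :: "('h::complex_hilbert \<Rightarrow> 'h) \<Rightarrow> 'h \<Rightarrow> 'h"
  where "cadjoint a = (THE b. \<forall>x y. cinner (a x) y = cinner x (b y))"

definition selfadjoint_unitary :: "('h::complex_hilbert \<Rightarrow> 'h) \<Rightarrow> bool"
  where "selfadjoint_unitary u \<longleftrightarrow>
    bounded_clinear u \<and> cadjoint u = u \<and> cadjoint u \<circ> u = id \<and> u \<circ> cadjoint u = id"

definition positive_operator :: "('h::complex_hilbert \<Rightarrow> 'h) \<Rightarrow> bool"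
  where "positive_operator a \<longleftrightarrow>
    bounded_clinear a \<and> (\<forall>x. cinner (a x) x \<in> \<real> \<and> 0 \<le> Re (cinner (a x) x))"

definition commutant :: "('h::complex_hilbert \<Rightarrow> 'h) set \<Rightarrow> ('h \<Rightarrow> 'h) set"
  where "commutant S = {b. bounded_clinear b \<and> (\<forall>a\<in>S. a \<circ> b = b \<circ> a)}"

definition von_neumann_algebra :: "('h::complex_hilbert \<Rightarrow> 'h) set \<Rightarrow> bool"
  where "von_neumann_algebra M \<longleftrightarrow>
    (\<forall>a\<in>M. bounded_clinear a) \<and> (\<forall>a\<in>M. cadjoint a \<in> M) \<and> commutant (commutant M) = M"

definition operator_linear_on ::
    "('h::complex_hilbert \<Rightarrow> 'h) set \<Rightarrow> (('h \<Rightarrow> 'h) \<Rightarrow> ('k::complex_hilbert \<Rightarrow> 'k)) \<Rightarrow> bool"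
  where "operator_linear_on A T \<longleftrightarrow>
    (\<forall>a\<in>A. \<forall>b\<in>A. T (\<lambda>x. a x + b x) = (\<lambda>y. T a y + T b y)) \<and>
    (\<forall>c. \<forall>a\<in>A. T (\<lambda>x. c *\<^sub>C a x) = (\<lambda>y. c *\<^sub>C T a y))"

definition positive_on ::
    "('h::complex_hilbert \<Rightarrow> 'h) set \<Rightarrow> (('h \<Rightarrow> 'h) \<Rightarrow> ('k::complex_hilbert \<Rightarrow> 'k)) \<Rightarrow> bool"
  where "positive_on A T \<longleftrightarrow> (\<forall>a\<in>A. positive_operator a \<longrightarrow> positive_operator (T a))"

definition faithful_on ::
    "('h::complex_hilbert \<Rightarrow> 'h) set \<Rightarrow> (('h \<Rightarrow> 'h) \<Rightarrow> ('k::complex_hilbert \<Rightarrow> 'k)) \<Rightarrow> bool"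
  where "faithful_on A T \<longleftrightarrow>
    (\<forall>a\<in>A. T (cadjoint a \<circ> a) = (\<lambda>_. 0) \<longrightarrow> a = (\<lambda>_. 0))"

definition star_automorphism ::
    "('h::complex_hilbert \<Rightarrow> 'h) set \<Rightarrow> (('h \<Rightarrow> 'h) \<Rightarrow> ('h \<Rightarrow> 'h)) \<Rightarrow> bool"
  where "star_automorphism M \<theta> \<longleftrightarrow>
    bij_betw \<theta> M M \<and> operator_linear_on M \<theta> \<and>
    (\<forall>a\<in>M. \<forall>b\<in>M. \<theta> (a \<circ> b) = \<theta> a \<circ> \<theta> b) \<and>
    (\<forall>a\<in>M. \<theta> (cadjoint a) = cadjoint (\<theta> a))"

definition Z2_grading ::
    "('h::complex_hilbert \<Rightarrow> 'h) set \<Rightarrow> (('h \<Rightarrow> 'h) \<Rightarrow> ('h \<Rightarrow> 'h)) \<Rightarrow> bool"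
  where "Z2_grading M \<theta> \<longleftrightarrow> star_automorphism M \<theta> \<and> (\<forall>a\<in>M. \<theta> (\<theta> a) = a)"

definition cyclic_vector :: "('h::complex_hilbert \<Rightarrow> 'h) set \<Rightarrow> 'h \<Rightarrow> bool"
  where "cyclic_vector M \<xi> \<longleftrightarrow> closure ((\<lambda>a. a \<xi>) ` M) = UNIV"

definition vector_state :: "'h::complex_hilbert \<Rightarrow> ('h \<Rightarrow> 'h) \<Rightarrow> complex"
  where "vector_state \<xi> a = cinner (a \<xi>) \<xi>"

definition even_state ::
    "('h::complex_hilbert \<Rightarrow> 'h) set \<Rightarrow> (('h \<Rightarrow> 'h) \<Rightarrow> ('h \<Rightarrow> 'h)) \<Rightarrow> 'h \<Rightarrow> bool"
  where "even_state M \<theta> \<xi> \<longleftrightarrow> (\<forall>a\<in>M. vector_state \<xi> (\<theta> a) = vector_state \<xi> a)"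

text \<open>
  The operator \<open>\<Gamma>\<close>: well defined for a grading \<open>\<theta>\<close>, a cyclic vector \<open>\<xi>\<close> and an even vector state.
\<close>

definition grading_unitary ::
    "('h::complex_hilbert \<Rightarrow> 'h) set \<Rightarrow> (('h \<Rightarrow> 'h) \<Rightarrow> ('h \<Rightarrow> 'h)) \<Rightarrow> 'h \<Rightarrow> 'h \<Rightarrow> 'h"
  where "grading_unitary M \<theta> \<xi> =
    (THE \<Gamma>. selfadjoint_unitary \<Gamma> \<and> (\<forall>a\<in>M. \<Gamma> (a \<xi>) = \<theta> a \<xi>))"

definition even_part :: "('h::complex_hilbert \<Rightarrow> 'h) \<Rightarrow> ('h \<Rightarrow> 'h) \<Rightarrow> 'h \<Rightarrow> 'h"
  where "even_part \<Gamma> a = (\<lambda>x. (1/2) *\<^sub>R (a x + \<Gamma> (a (\<Gamma> x))))"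

definition odd_part :: "('h::complex_hilbert \<Rightarrow> 'h) \<Rightarrow> ('h \<Rightarrow> 'h) \<Rightarrow> 'h \<Rightarrow> 'h"
  where "odd_part \<Gamma> a = (\<lambda>x. (1/2) *\<^sub>R (a x - \<Gamma> (a (\<Gamma> x))))"

lemma even_odd_part_unique:
  assumes \<Gamma>: "selfadjoint_unitary \<Gamma>"
  shows "a = (\<lambda>x. p x + q x) \<and> \<Gamma> \<circ> p \<circ> \<Gamma> = p \<and> \<Gamma> \<circ> q \<circ> \<Gamma> = (\<lambda>x. - q x)
    \<longleftrightarrow> p = even_part \<Gamma> a \<and> q = odd_part \<Gamma> a"
proof -
  interpret bounded_linear \<Gamma>
    using \<Gamma> by (simp add: selfadjoint_unitary_def bounded_clinear_def)
  have inv [simp]: "\<Gamma> (\<Gamma> x) = x" for x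
    using \<Gamma> by (metis comp_apply id_apply selfadjoint_unitary_def)
  have half: "(1/2) *\<^sub>R u + (1/2) *\<^sub>R u = u" for u :: 'a
    by (simp flip: scaleR_add_left)
  have "a = (\<lambda>x. even_part \<Gamma> a x + odd_part \<Gamma> a x)"
    by (simp add: even_part_def odd_part_def scaleR_add_right scaleR_diff_right half)
  moreover have "\<Gamma> \<circ> even_part \<Gamma> a \<circ> \<Gamma> = even_part \<Gamma> a"
    "\<Gamma> \<circ> odd_part \<Gamma> a \<circ> \<Gamma> = (\<lambda>x. - odd_part \<Gamma> a x)"
    by (simp_all add: fun_eq_iff even_part_def odd_part_def add diff scaleR algebra_simps)
  moreover have "p = even_part \<Gamma> a \<and> q = odd_part \<Gamma> a"
    if "a = (\<lambda>x. p x + q x)" "\<Gamma> \<circ> p \<circ> \<Gamma> = p" "\<Gamma> \<circ> q \<circ> \<Gamma> = (\<lambda>x. - q x)"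
    using that by (simp add: fun_eq_iff even_part_def odd_part_def add algebra_simps half)
  ultimately show ?thesis
    by metis
qed

definition twist :: "('h::complex_hilbert \<Rightarrow> 'h) \<Rightarrow> ('h \<Rightarrow> 'h) \<Rightarrow> 'h \<Rightarrow> 'h"
  where "twist \<Gamma> a = (\<lambda>x. even_part \<Gamma> a x + \<Gamma> (odd_part \<Gamma> a x))"

definition twisted_commutant ::
    "('h::complex_hilbert \<Rightarrow> 'h) set \<Rightarrow> (('h \<Rightarrow> 'h) \<Rightarrow> ('h \<Rightarrow> 'h)) \<Rightarrow> 'h \<Rightarrow> ('h \<Rightarrow> 'h) set"
  where "twisted_commutant M \<theta> \<xi> = twist (grading_unitary M \<theta> \<xi>) ` commutant M"

text \<open>
  Maps between operator algebras are total functions of which only the values on the domain matter;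
  \<open>\<rightarrow>\<^sub>E\<close> fixes the values off the domain, so that uniqueness can be asserted as equality.
  Linearity is not part of the predicate.
\<close>

definition twisted_dual_map ::
    "('h::complex_hilbert \<Rightarrow> 'h) set \<Rightarrow> (('h \<Rightarrow> 'h) \<Rightarrow> ('h \<Rightarrow> 'h)) \<Rightarrow> 'h \<Rightarrow>
     ('k::complex_hilbert \<Rightarrow> 'k) set \<Rightarrow> (('k \<Rightarrow> 'k) \<Rightarrow> ('k \<Rightarrow> 'k)) \<Rightarrow> 'k \<Rightarrow>
     (('h \<Rightarrow> 'h) \<Rightarrow> ('k \<Rightarrow> 'k)) \<Rightarrow> (('k \<Rightarrow> 'k) \<Rightarrow> ('h \<Rightarrow> 'h)) \<Rightarrow> bool"
  where "twisted_dual_map M \<theta>\<^sub>\<mu> \<xi>\<^sub>\<mu> N \<theta>\<^sub>\<nu> \<xi>\<^sub>\<nu> \<Psi> \<Phi> \<longleftrightarrow>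
    \<Phi> \<in> twisted_commutant N \<theta>\<^sub>\<nu> \<xi>\<^sub>\<nu> \<rightarrow>\<^sub>E twisted_commutant M \<theta>\<^sub>\<mu> \<xi>\<^sub>\<mu> \<and>
    \<Phi> id = id \<and>
    (\<forall>a\<in>M. \<forall>b\<in>twisted_commutant N \<theta>\<^sub>\<nu> \<xi>\<^sub>\<nu>.
      cinner (\<Phi> b (a \<xi>\<^sub>\<mu>)) \<xi>\<^sub>\<mu> = cinner (b (\<Psi> a \<xi>\<^sub>\<nu>)) \<xi>\<^sub>\<nu>)"

end

theory Submission
  imports Defs
begin

text \<open>
  For a self-adjoint unitary \<open>\<Gamma>\<close>, the twist \<open>\<kappa>(b) = b\<^sub>+ + \<Gamma> b\<^sub>-\<close> is a linear involution. As
  \<open>\<Gamma> \<xi> = \<xi>\<close> for the grading unitaries, \<open>\<langle>\<kappa>(b) x, \<xi>\<rangle> = \<langle>b x, \<xi>\<rangle>\<close>: the defining relation of the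
  dual map does not see the twists, and the map is \<open>\<kappa>\<^sub>\<mu> \<circ> T \<circ> \<kappa>\<^sub>\<nu>\<close>, where \<open>T\<close> sends an operator \<open>b\<close>
  of \<open>N'\<close> to the operator \<open>t\<close> of \<open>M'\<close> with
  \<open>\<langle>t a \<xi>\<^sub>\<mu>, \<xi>\<^sub>\<mu>\<rangle> = \<langle>b \<Psi>(a) \<xi>\<^sub>\<nu>, \<xi>\<^sub>\<nu>\<rangle>\<close>. Uniqueness of \<open>t\<close>, and with it linearity and
  preservation of the unit, holds because \<open>\<xi>\<^sub>\<mu>\<close> is cyclic (\<open>commutant_eqI\<close>).

  Existence of \<open>t\<close> (\<open>ex_dual_operator\<close>) is a Radon-Nikodym theorem. A positive operator \<open>a\<close>
  commuting with \<open>b\<close> satisfies \<open>\<bar>\<langle>b a x, x\<rangle>\<bar> \<le> \<parallel>b\<parallel> \<langle>a x, x\<rangle>\<close>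
  (\<open>cinner_commuting_positive_le\<close>). For \<open>\<phi>(a) = \<langle>b \<Psi>(a) \<xi>\<^sub>\<nu>, \<xi>\<^sub>\<nu>\<rangle>\<close> this bounds \<open>\<bar>\<phi>(a\<^sup>* a)\<bar>\<close> by
  \<open>\<parallel>b\<parallel> \<parallel>a \<xi>\<^sub>\<mu>\<parallel>\<^sup>2\<close>, and polarisation bounds \<open>\<bar>\<phi>(c\<^sup>* a)\<bar>\<close> by
  \<open>2 \<parallel>b\<parallel> \<parallel>a \<xi>\<^sub>\<mu>\<parallel> \<parallel>c \<xi>\<^sub>\<mu>\<parallel>\<close>. The Riesz theorem then yields \<open>z\<close> with \<open>\<phi>(a) = \<langle>a \<xi>\<^sub>\<mu>, z\<rangle>\<close>,
  and \<open>t\<close> is the adjoint of the bounded operator \<open>a \<xi>\<^sub>\<mu> \<mapsto> a z\<close>, which commutes with \<open>M\<close>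
  (\<open>radon_nikodym_commutant\<close>).

  If \<open>\<Psi>\<close> is unital, the case \<open>a = 1\<close> of the defining relation says that the states correspond.
  Faithfulness follows: if the dual map kills \<open>w\<^sup>* w\<close>, then \<open>\<parallel>w \<xi>\<^sub>\<nu>\<parallel> = 0\<close>, and \<open>\<xi>\<^sub>\<nu>\<close> separates the
  twisted commutant (\<open>twist_separating\<close>).
\<close>

section \<open>Complex inner products and bounded operators\<close>

lemma cinner_add_right: "cinner x (y + z) = cinner x y + cinner x z"
  by (metis cinner_add_left cinner_commute complex_cnj_add)

lemma cinner_scaleC_right: "cinner x (c *\<^sub>C y) = cnj c * cinner x y"
  by (metis cinner_scaleC_left cinner_commute complex_cnj_mult)

lemma cinner_scaleR_left: "cinner (r *\<^sub>R x) y = of_real r * cinner x y"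
  by (metis cinner_scaleC_left scaleC_of_real)

lemma cinner_scaleR_right: "cinner x (r *\<^sub>R y) = of_real r * cinner x y"
  by (metis cinner_scaleC_right scaleC_of_real complex_cnj_complex_of_real)

lemma cinner_minus_left: "cinner (- x) y = - cinner x y"
  using cinner_scaleR_left[of "-1" x y] by simp

lemma cinner_minus_right: "cinner x (- y) = - cinner x y"
  using cinner_scaleR_right[of x "-1" y] by simp

lemma cinner_diff_left: "cinner (x - y) z = cinner x z - cinner y z"
  using cinner_add_left[of x "- y" z] by (simp add: cinner_minus_left)

lemma cinner_diff_right: "cinner x (y - z) = cinner x y - cinner x z"
  using cinner_add_right[of x y "- z"] by (simp add: cinner_minus_right)

lemma cinner_zero_left [simp]: "cinner 0 x = 0"
  using cinner_scaleR_left[of 0 x x] by simp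

lemma cinner_zero_right [simp]: "cinner x 0 = 0"
  using cinner_scaleR_right[of x 0 x] by simp

lemmas cinner_distribs =
  cinner_add_left cinner_add_right cinner_scaleC_left cinner_scaleC_right
  cinner_diff_left cinner_diff_right cinner_minus_left cinner_minus_right

lemma scaleC_zero_left [simp]: "0 *\<^sub>C x = 0"
  using scaleC_of_real[of 0 x] by simp

lemma scaleC_minus_one: "(- 1) *\<^sub>C x = - x"
  using scaleC_of_real[of "-1" x] by simp

lemma scaleC_zero_right [simp]: "c *\<^sub>C 0 = 0"
  using scaleC_scaleC[of c 0 0] by simp

lemma scaleC_minus_right: "c *\<^sub>C (- x) = - (c *\<^sub>C x)"
  by (metis mult.commute scaleC_minus_one scaleC_scaleC)

lemma scaleC_diff_right: "c *\<^sub>C (x - y) = c *\<^sub>C x - c *\<^sub>C y"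
  using scaleC_add_right[of c x "- y"] by (simp add: scaleC_minus_right)

lemma cinner_self: "cinner x x = of_real ((norm x)\<^sup>2)"
proof -
  have "Im (cinner x x) = 0"
    using arg_cong[OF cinner_commute[of x x], of Im] by simp
  then show ?thesis
    by (simp add: complex_eq_iff Re_cinner power2_norm_eq_inner)
qed

lemma norm_scaleC: "norm (c *\<^sub>C x) = cmod c * norm x"
proof -
  have "cinner (c *\<^sub>C x) (c *\<^sub>C x) = of_real ((cmod c * norm x)\<^sup>2)"
    using complex_norm_square[of c]
    by (simp add: cinner_scaleC_left cinner_scaleC_right cinner_self[of x] power_mult_distrib
        ac_simps)
  then have "(norm (c *\<^sub>C x))\<^sup>2 = (cmod c * norm x)\<^sup>2"
    by (simp only: cinner_self of_real_eq_iff)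
  then show ?thesis
    by simp
qed

lemma norm_cinner_le: "cmod (cinner x y) \<le> norm x * norm y"
proof (cases "cinner x y = 0")
  case False
  define u where "u = cnj (sgn (cinner x y))"
  have "u * cinner x y = of_real (cmod (cinner x y))"
    using False complex_norm_square[of "cinner x y"]
    by (simp add: u_def sgn_div_norm scaleR_conv_of_real power2_eq_square field_simps)
  then have "cmod (cinner x y) = (u *\<^sub>C x) \<bullet> y"
    by (metis Re_complex_of_real Re_cinner cinner_scaleC_left)
  also have "\<dots> \<le> norm (u *\<^sub>C x) * norm y"
    by (rule norm_cauchy_schwarz)
  also have "norm (u *\<^sub>C x) = norm x"
    using False by (simp add: norm_scaleC u_def norm_sgn)
  finally show ?thesis .
qed simp

lemma cinner_eq_of_dense:
  assumes "closure D = UNIV" "\<And>y. y \<in> D \<Longrightarrow> cinner y u = cinner y v"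
  shows "u = v"
proof -
  have "D \<subseteq> {y. y \<bullet> (u - v) = 0}"
    using assms(2) by (auto simp flip: Re_cinner simp: cinner_diff_right)
  moreover have "closed {y. y \<bullet> (u - v) = 0}"
    by (intro closed_Collect_eq continuous_intros)
  ultimately have "u - v \<in> {y. y \<bullet> (u - v) = 0}"
    using closure_minimal assms(1) by blast
  then show ?thesis
    by simp
qed

lemma norm_le_of_dense:
  assumes "closure D = UNIV" "\<And>y. y \<in> D \<Longrightarrow> cmod (cinner y w) \<le> K * norm y" "0 \<le> K"
  shows "norm w \<le> K"
proof -
  have "y \<bullet> w \<le> K * norm y" if "y \<in> D" for y
    using assms(2)[OF that] complex_Re_le_cmod[of "cinner y w"] by (simp add: Re_cinner)
  then have "D \<subseteq> {y. y \<bullet> w \<le> K * norm y}"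
    by blast
  moreover have "closed {y. y \<bullet> w \<le> K * norm y}"
    by (intro closed_Collect_le continuous_intros)
  ultimately have "w \<in> {y. y \<bullet> w \<le> K * norm y}"
    using closure_minimal assms(1) by blast
  then have "norm w * norm w \<le> K * norm w"
    by (simp add: power2_eq_square flip: power2_norm_eq_inner)
  then show ?thesis
    using assms(3) by (cases "w = 0") auto
qed


lemma bounded_clinearI:
  assumes "\<And>x y. a (x + y) = a x + a y" "\<And>c x. a (c *\<^sub>C x) = c *\<^sub>C a x"
    and "\<And>x. norm (a x) \<le> K * norm x"
  shows "bounded_clinear a"
  unfolding bounded_clinear_def
proof (intro conjI allI assms(2))
  show "bounded_linear a"
    using assms by (intro bounded_linear_intro[where K = K])
      (auto simp: mult.commute simp flip: scaleC_of_real)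
qed

lemma bounded_clinear_linear: "bounded_clinear a \<Longrightarrow> bounded_linear a"
  by (simp add: bounded_clinear_def)

lemma bounded_clinear_scaleC: "bounded_clinear a \<Longrightarrow> a (c *\<^sub>C x) = c *\<^sub>C a x"
  by (simp add: bounded_clinear_def)

lemmas bounded_clinear_add = linear_add[OF bounded_linear.linear[OF bounded_clinear_linear]]
lemmas bounded_clinear_diff = linear_diff[OF bounded_linear.linear[OF bounded_clinear_linear]]
lemmas bounded_clinear_minus = linear_neg[OF bounded_linear.linear[OF bounded_clinear_linear]]
lemmas bounded_clinear_zero = linear_0[OF bounded_linear.linear[OF bounded_clinear_linear]]
lemmas bounded_clinear_scaleR =
  linear_cmul[OF bounded_linear.linear[OF bounded_clinear_linear]]

lemmas bounded_clinear_simps =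
  bounded_clinear_add bounded_clinear_diff bounded_clinear_minus bounded_clinear_zero
  bounded_clinear_scaleC bounded_clinear_scaleR

lemma bounded_clinear_bound:
  assumes "bounded_clinear a"
  obtains K where "0 \<le> K" "\<And>x. norm (a x) \<le> K * norm x"
  using bounded_linear.nonneg_bounded[OF bounded_clinear_linear[OF assms]]
  by (metis mult.commute)

lemma bounded_clinear_id: "bounded_clinear id"
  by (simp add: bounded_clinear_def id_def bounded_linear_ident)

lemma bounded_clinear_comp:
  "bounded_clinear a \<Longrightarrow> bounded_clinear b \<Longrightarrow> bounded_clinear (a \<circ> b)"
  by (simp add: bounded_clinear_def comp_def bounded_linear_compose)

lemma bounded_clinear_plus:
  "bounded_clinear a \<Longrightarrow> bounded_clinear b \<Longrightarrow> bounded_clinear (\<lambda>x. a x + b x)"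
  by (simp add: bounded_clinear_def bounded_linear_add scaleC_add_right)

lemma bounded_clinear_times:
  assumes "bounded_clinear a"
  shows "bounded_clinear (\<lambda>x. c *\<^sub>C a x)"
proof -
  obtain K where K: "0 \<le> K" "\<And>x. norm (a x) \<le> K * norm x"
    using bounded_clinear_bound[OF assms] by blast
  show ?thesis
  proof (rule bounded_clinearI)
    show "norm (c *\<^sub>C a x) \<le> (cmod c * K) * norm x" for x
      using mult_left_mono[OF K(2), of "cmod c" x] by (simp add: norm_scaleC mult.assoc)
  qed (use assms in \<open>auto simp: bounded_clinear_simps scaleC_add_right scaleC_scaleC mult.commute\<close>)
qed

lemma bounded_clinear_eq_of_dense:
  assumes "bounded_clinear a" "bounded_clinear b" "closure D = UNIV"
    and "\<And>x. x \<in> D \<Longrightarrow> a x = b x"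
  shows "a = b"
proof -
  have "continuous_on UNIV a" "continuous_on UNIV b"
    using assms(1,2) by (simp_all add: bounded_clinear_def linear_continuous_on)
  then have "closed {x. a x = b x}"
    by (intro closed_Collect_eq)
  moreover have "D \<subseteq> {x. a x = b x}"
    using assms(4) by blast
  ultimately have "UNIV \<subseteq> {x. a x = b x}"
    using closure_minimal assms(3) by metis
  then show ?thesis
    by auto
qed

section \<open>Riesz representation and adjoints for bounded linear relations\<close>

text \<open>A bounded real linear functional on a subspace, given by its graph \<open>G\<close>, is an inner product.
  The representing vector is the limit of a minimising sequence of
  \<open>\<parallel>y\<parallel>\<^sup>2 - 2 r\<close> over \<open>(y, r) \<in> G\<close>. Working with graphs spares the proof that the functional is
  well defined, which the bound entails.\<close>

lemma riesz_relation_real: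
  fixes G :: "('a::{real_inner, complete_space} \<times> real) set"
  assumes G: "subspace G" and bound: "\<And>y r. (y, r) \<in> G \<Longrightarrow> \<bar>r\<bar> \<le> K * norm y"
  shows "\<exists>z. \<forall>(y, r)\<in>G. r = y \<bullet> z"
proof -
  define q where "q = (\<lambda>p::'a \<times> real. (norm (fst p))\<^sup>2 - 2 * snd p)"
  define m where "m = Inf (q ` G)"
  have "- K\<^sup>2 \<le> q p" if "p \<in> G" for p
  proof -
    have "snd p \<le> K * norm (fst p)"
      using bound[of "fst p" "snd p"] that by simp
    moreover have "0 \<le> (norm (fst p) - K)\<^sup>2"
      by simp
    ultimately show ?thesis
      by (simp add: q_def power2_eq_square algebra_simps)
  qed
  then have bdd: "bdd_below (q ` G)"
    by (meson bdd_belowI2)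
  have m_le: "m \<le> q p" if "p \<in> G" for p
    using bdd that by (simp add: m_def cInf_lower)
  have "\<exists>p\<in>G. q p < m + 1 / real (Suc n)" for n
  proof -
    have "q ` G \<noteq> {}"
      using subspace_0[OF G] by blast
    then show ?thesis
      using cInf_lessD[of "q ` G" "m + 1 / real (Suc n)"] by (auto simp: m_def)
  qed
  then obtain p where p: "\<And>n. p n \<in> G" "\<And>n. q (p n) < m + 1 / real (Suc n)"
    by metis
  \<comment> \<open>Parallelogram law: two near-minimisers are close, since their midpoint is again in \<open>G\<close>.\<close>
  have close: "(norm (fst (p i) - fst (p j)))\<^sup>2 \<le> 2 / real (Suc i) + 2 / real (Suc j)" for i j
  proof -
    have "(1/2) *\<^sub>R (p i + p j) \<in> G"
      using G p(1) by (simp add: subspace_add subspace_scale)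
    from m_le[OF this] have "m \<le> q ((1/2) *\<^sub>R (p i + p j))" .
    moreover have "(norm (fst (p i) - fst (p j)))\<^sup>2
        = 2 * q (p i) + 2 * q (p j) - 4 * q ((1/2) *\<^sub>R (p i + p j))"
      unfolding q_def power2_norm_eq_inner
      by (simp add: inner_simps inner_commute[of "fst (p j)" "fst (p i)"] field_simps)
    ultimately show ?thesis
      using p(2)[of i] p(2)[of j] by simp
  qed
  have "Cauchy (\<lambda>n. fst (p n))"
  proof (rule metric_CauchyI)
    fix e :: real
    assume "0 < e"
    then obtain N where N: "4 / e\<^sup>2 < real N"
      using reals_Archimedean2 by blast
    then have "0 < N"
      using \<open>0 < e\<close> by (cases N) (auto simp: field_simps)
    have "dist (fst (p i)) (fst (p j)) < e" if "i \<ge> N" "j \<ge> N" for i j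
    proof -
      have "2 / real (Suc k) < e\<^sup>2 / 2" if "k \<ge> N" for k
      proof -
        have "4 / e\<^sup>2 < real (Suc k)"
          using N that by simp
        then show ?thesis
          using \<open>0 < e\<close> by (simp add: field_simps)
      qed
      from this[OF that(1)] this[OF that(2)] close[of i j]
      have "(norm (fst (p i) - fst (p j)))\<^sup>2 < e\<^sup>2"
        by simp
      then show ?thesis
        using \<open>0 < e\<close> by (simp add: dist_norm power_less_imp_less_base)
    qed
    then show "\<exists>M. \<forall>i\<ge>M. \<forall>j\<ge>M. dist (fst (p i)) (fst (p j)) < e"
      by blast
  qed
  then obtain z where z: "(\<lambda>n. fst (p n)) \<longlonglongrightarrow> z"
    using Cauchy_convergent convergent_def by blast
  have quad: "0 \<le> 2 * t * (y \<bullet> z - r) + t\<^sup>2 * (norm y)\<^sup>2" if "(y, r) \<in> G" for y r t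
  proof -
    have "0 \<le> 1 / real (Suc n) + (2 * t * (y \<bullet> fst (p n) - r) + t\<^sup>2 * (norm y)\<^sup>2)" for n
    proof -
      have "p n + t *\<^sub>R (y, r) \<in> G"
        using G p(1) that by (intro subspace_add subspace_scale)
      from m_le[OF this] p(2)[of n] have "0 \<le> 1 / real (Suc n) + (q (p n + t *\<^sub>R (y, r)) - q (p n))"
        by simp
      then show ?thesis
        unfolding q_def power2_norm_eq_inner
        by (simp add: inner_simps inner_commute[of "fst (p n)" y] power2_eq_square algebra_simps)
    qed
    moreover have "(\<lambda>n. 1 / real (Suc n) + (2 * t * (y \<bullet> fst (p n) - r) + t\<^sup>2 * (norm y)\<^sup>2))
        \<longlonglongrightarrow> 0 + (2 * t * (y \<bullet> z - r) + t\<^sup>2 * (norm y)\<^sup>2)"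
      by (intro tendsto_intros z LIMSEQ_Suc[OF lim_1_over_n])
    ultimately have "0 \<le> 0 + (2 * t * (y \<bullet> z - r) + t\<^sup>2 * (norm y)\<^sup>2)"
      by (intro LIMSEQ_le_const) auto
    then show ?thesis
      by simp
  qed
  have "r = y \<bullet> z" if "(y, r) \<in> G" for y r
  proof (rule ccontr)
    assume "r \<noteq> y \<bullet> z"
    define d where "d = y \<bullet> z - r"
    define c where "c = (norm y)\<^sup>2 + 1"
    have c: "0 < c" "(norm y)\<^sup>2 < 2 * c" and "d \<noteq> 0"
      using \<open>r \<noteq> y \<bullet> z\<close> by (auto simp: d_def c_def add_nonneg_pos)
    have "0 \<le> 2 * (- d / c) * d + (- d / c)\<^sup>2 * (norm y)\<^sup>2"
      using quad[OF that, of "- d / c"] by (simp add: d_def)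
    also have "\<dots> = (d\<^sup>2 / c\<^sup>2) * ((norm y)\<^sup>2 - 2 * c)"
      using c(1) by (simp add: power2_eq_square field_simps)
    also have "\<dots> < 0"
      using c \<open>d \<noteq> 0\<close> by (intro mult_pos_neg) auto
    finally show False
      by simp
  qed
  then show ?thesis
    by blast
qed

lemma riesz_relation:
  fixes G :: "('h::complex_hilbert \<times> complex) set"
  assumes add: "\<And>x y r s. (x, r) \<in> G \<Longrightarrow> (y, s) \<in> G \<Longrightarrow> (x + y, r + s) \<in> G"
    and scale: "\<And>c x r. (x, r) \<in> G \<Longrightarrow> (c *\<^sub>C x, c * r) \<in> G"
    and zero: "(0, 0) \<in> G"
    and bound: "\<And>y r. (y, r) \<in> G \<Longrightarrow> cmod r \<le> K * norm y"
  shows "\<exists>z. \<forall>(y, r)\<in>G. r = cinner y z"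
proof -
  let ?G = "(\<lambda>(y, r). (y, Re r)) ` G"
  have "subspace ?G"
  proof (rule subspaceI)
    show "0 \<in> ?G"
      using zero by (force simp: zero_prod_def)
    show "x + y \<in> ?G" if "x \<in> ?G" "y \<in> ?G" for x y
      using that add by force
    show "c *\<^sub>R x \<in> ?G" if "x \<in> ?G" for c x
      using that scale[of _ _ "of_real c"] by (force simp: scaleC_of_real)
  qed
  moreover have "\<bar>r\<bar> \<le> K * norm y" if "(y, r) \<in> ?G" for y r
    using that bound abs_Re_le_cmod order_trans by fastforce
  ultimately have "\<exists>z. \<forall>(y, r)\<in>?G. r = y \<bullet> z"
    by (rule riesz_relation_real)
  then obtain z where z: "\<And>y r. (y, r) \<in> ?G \<Longrightarrow> r = y \<bullet> z"
    by blast
  have Re: "Re r = Re (cinner y z)" if "(y, r) \<in> G" for y r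
    using z[of y "Re r"] that by (force simp: Re_cinner)
  have "r = cinner y z" if "(y, r) \<in> G" for y r
    using Re[OF that] Re[OF scale[OF that, of \<i>]]
    by (simp add: complex_eq_iff cinner_scaleC_left)
  then show ?thesis
    by blast
qed

text \<open>The adjoint of a bounded linear operator with dense domain, given by its graph.\<close>

lemma adjoint_relation:
  fixes G :: "('h::complex_hilbert \<times> 'h) set"
  assumes add: "\<And>x y u v. (x, u) \<in> G \<Longrightarrow> (y, v) \<in> G \<Longrightarrow> (x + y, u + v) \<in> G"
    and scale: "\<And>c x u. (x, u) \<in> G \<Longrightarrow> (c *\<^sub>C x, c *\<^sub>C u) \<in> G"
    and dense: "closure (fst ` G) = UNIV"
    and bound: "\<And>x u. (x, u) \<in> G \<Longrightarrow> norm u \<le> K * norm x" and K: "0 \<le> K"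
  shows "\<exists>T. bounded_clinear T \<and> (\<forall>(x, u)\<in>G. \<forall>h. cinner u h = cinner x (T h))"
proof -
  have "G \<noteq> {}"
    using dense by auto
  then have zero: "(0, 0) \<in> G"
    using scale[of _ _ 0] by auto
  have "\<exists>z. \<forall>(x, u)\<in>G. cinner u h = cinner x z" for h
  proof -
    let ?G = "(\<lambda>(x, u). (x, cinner u h)) ` G"
    have "\<exists>z. \<forall>(x, r)\<in>?G. r = cinner x z"
    proof (rule riesz_relation)
      show "(x + y, r + s) \<in> ?G" if "(x, r) \<in> ?G" "(y, s) \<in> ?G" for x y r s
        using that by (auto simp: image_iff cinner_add_left intro!: bexI[OF _ add])
      show "(c *\<^sub>C x, c * r) \<in> ?G" if "(x, r) \<in> ?G" for c x r
        using that by (auto simp: image_iff cinner_scaleC_left intro!: bexI[OF _ scale])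
      show "(0, 0) \<in> ?G"
        using zero by force
      show "cmod r \<le> (K * norm h) * norm x" if xr: "(x, r) \<in> ?G" for x r
      proof -
        obtain u where u: "(x, u) \<in> G" "r = cinner u h"
          using xr by auto
        have "cmod r \<le> norm u * norm h"
          using u(2) norm_cinner_le by simp
        also have "\<dots> \<le> (K * norm x) * norm h"
          using bound[OF u(1)] by (simp add: mult_right_mono)
        finally show ?thesis
          by (simp add: mult_ac)
      qed
    qed
    then obtain z where z: "\<forall>(x, r)\<in>?G. r = cinner x z"
      by blast
    have "cinner u h = cinner x z" if "(x, u) \<in> G" for x u
      using bspec[OF z imageI[OF that]] by simp
    then show ?thesis
      by blast
  qed
  then obtain T where T: "\<And>x u h. (x, u) \<in> G \<Longrightarrow> cinner u h = cinner x (T h)"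
    by (metis (mono_tags, lifting) case_prodD)
  have eqI: "v = w" if "\<And>x u. (x, u) \<in> G \<Longrightarrow> cinner x v = cinner x w" for v w
    using that by (intro cinner_eq_of_dense[OF dense]) auto
  have "bounded_clinear T"
  proof (rule bounded_clinearI)
    show "T (g + h) = T g + T h" for g h
      by (rule eqI) (simp add: cinner_add_right flip: T)
    show "T (c *\<^sub>C h) = c *\<^sub>C T h" for c h
      by (rule eqI) (simp add: cinner_scaleC_right flip: T)
    show "norm (T h) \<le> K * norm h" for h
    proof (rule norm_le_of_dense[OF dense])
      fix x assume "x \<in> fst ` G"
      then obtain u where u: "(x, u) \<in> G"
        by auto
      have "cmod (cinner x (T h)) \<le> norm u * norm h"
        by (metis T[OF u] norm_cinner_le)
      also have "\<dots> \<le> (K * norm x) * norm h"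
        using bound[OF u] by (simp add: mult_right_mono)
      finally show "cmod (cinner x (T h)) \<le> K * norm h * norm x"
        by (simp add: mult_ac)
    qed (use K in simp)
  qed
  then show ?thesis
    using T by blast
qed

lemma cinner_eqI: "(\<And>y. cinner y u = cinner y v) \<Longrightarrow> u = v"
  using cinner_eq_of_dense[of UNIV u v] by simp

lemma cadjoint_eqI:
  assumes "\<And>x y. cinner (a x) y = cinner x (b y)"
  shows "cadjoint a = b"
  unfolding cadjoint_def
proof (rule the_equality)
  show "b' = b" if "\<forall>x y. cinner (a x) y = cinner x (b' y)" for b'
    using that assms cinner_eqI[of "b' _" "b _"] by (metis ext)
qed (use assms in blast)

lemma
  assumes "bounded_clinear a"
  shows bounded_clinear_cadjoint: "bounded_clinear (cadjoint a)"
    and cinner_cadjoint: "cinner (a x) y = cinner x (cadjoint a y)"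
proof -
  let ?G = "range (\<lambda>x. (x, a x))"
  obtain K where K: "0 \<le> K" "\<And>x. norm (a x) \<le> K * norm x"
    using bounded_clinear_bound[OF assms] by blast
  have "\<exists>T. bounded_clinear T \<and> (\<forall>(x, u)\<in>?G. \<forall>h. cinner u h = cinner x (T h))"
  proof (rule adjoint_relation[OF _ _ _ _ K(1)])
    have "fst ` ?G = UNIV"
      by force
    then show "closure (fst ` ?G) = UNIV"
      by simp
  qed (use K(2) in \<open>auto simp: bounded_clinear_simps[OF assms]\<close>)
  then obtain T where T: "bounded_clinear T" "\<And>x y. cinner (a x) y = cinner x (T y)"
    by auto
  then have "cadjoint a = T"
    by (intro cadjoint_eqI)
  then show "bounded_clinear (cadjoint a)" "cinner (a x) y = cinner x (cadjoint a y)"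
    using T by simp_all
qed

lemma cinner_cadjoint_left:
  "bounded_clinear a \<Longrightarrow> cinner (cadjoint a x) y = cinner x (a y)"
  by (metis cinner_cadjoint cinner_commute)

lemma cadjoint_id: "cadjoint id = id"
  by (intro cadjoint_eqI) simp

lemma positive_operator_cadjoint_comp:
  assumes "bounded_clinear a"
  shows "positive_operator (cadjoint a \<circ> a)"
  unfolding positive_operator_def
  using assms by (simp add: bounded_clinear_comp bounded_clinear_cadjoint cinner_cadjoint_left
      cinner_self)

section \<open>Positive operators and commuting factors\<close>

lemma positive_operator_symmetric:
  assumes "positive_operator a"
  shows "cinner (a x) y = cinner x (a y)"
proof -
  have a: "bounded_clinear a"
    using assms by (simp add: positive_operator_def)
  have real: "Im (cinner (a z) z) = 0" for z
    using assms by (simp add: positive_operator_def complex_is_Real_iff)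
  have "Im (cinner (a x) y) + Im (cinner (a y) x) = 0"
    using real[of "x + y"] real[of x] real[of y]
    by (simp add: bounded_clinear_simps[OF a] cinner_distribs)
  moreover have "Re (cinner (a x) y) = Re (cinner (a y) x)"
    using real[of "\<i> *\<^sub>C x + y"] real[of x] real[of y]
    by (simp add: bounded_clinear_simps[OF a] cinner_distribs)
  ultimately show ?thesis
    using cinner_commute[of x "a y"] by (simp add: complex_eq_iff)
qed

text \<open>If a bounded \<open>b\<close> commutes with \<open>0 \<le> a \<le> 1\<close>, then
  \<open>\<bar>\<langle>b a x, x\<rangle>\<bar> \<le> \<parallel>b\<parallel> \<langle>a x, x\<rangle>\<close>. The recursion \<open>a\<^sub>0 = a\<close>,
  \<open>a\<^sub>n\<^sub>+\<^sub>1 = a\<^sub>n - a\<^sub>n\<^sup>2\<close> stays between \<open>0\<close> and \<open>1\<close>, tends strongly to \<open>0\<close>, and writes \<open>a\<close> as the strong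
  sum of the squares \<open>a\<^sub>n\<^sup>2\<close>, all of which commute with \<open>b\<close>. No square root of \<open>a\<close> is needed.\<close>

lemma cinner_commuting_contraction_le:
  fixes a b :: "'h::complex_hilbert \<Rightarrow> 'h"
  assumes a: "positive_operator a" and contr: "\<And>x. Re (cinner (a x) x) \<le> (norm x)\<^sup>2"
    and b: "bounded_clinear b" "\<And>x. norm (b x) \<le> K * norm x"
    and comm: "\<And>x. b (a x) = a (b x)"
  shows "cmod (cinner (b (a x)) x) \<le> K * Re (cinner (a x) x)"
proof -
  define s where "s = rec_nat a (\<lambda>_ t x. t x - t (t x))"
  have s0: "s 0 = a" and sSuc: "s (Suc n) x = s n x - s n (s n x)" for n x
    by (simp_all add: s_def)
  define Q where "Q = (\<lambda>n x. Re (cinner (s n x) x))"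
  have s: "bounded_clinear (s n) \<and> (\<forall>x y. cinner (s n x) y = cinner x (s n y)) \<and>
      (\<forall>x. 0 \<le> Q n x \<and> Q n x \<le> (norm x)\<^sup>2) \<and> (\<forall>x. b (s n x) = s n (b x))" for n
  proof (induction n)
    case 0
    then show ?case
      using a contr comm positive_operator_symmetric[OF a]
      by (simp add: s0 Q_def positive_operator_def)
  next
    case (Suc n)
    then have lin: "bounded_clinear (s n)" and sym: "\<And>x y. cinner (s n x) y = cinner x (s n y)"
      and Q: "\<And>x. 0 \<le> Q n x" "\<And>x. Q n x \<le> (norm x)\<^sup>2" and cm: "\<And>x. b (s n x) = s n (b x)"
      by blast+
    have eq: "s (Suc n) = (\<lambda>x. s n x + (- 1) *\<^sub>C (s n \<circ> s n) x)"
      by (simp add: fun_eq_iff sSuc scaleC_minus_one)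
    have "bounded_clinear (s (Suc n))"
      unfolding eq by (intro bounded_clinear_plus bounded_clinear_times bounded_clinear_comp lin)
    moreover have "cinner (s (Suc n) x) y = cinner x (s (Suc n) y)" for x y
      by (simp add: sSuc cinner_distribs sym)
    moreover have QS: "Q (Suc n) x = Q n x - (norm (s n x))\<^sup>2" for x
      using sym[of "s n x" x] by (simp add: Q_def sSuc cinner_distribs cinner_self)
    moreover have "0 \<le> Q (Suc n) x" for x
    proof -
      \<comment> \<open>\<open>t - t\<^sup>2 = t (1 - t) t + (1 - t) t (1 - t)\<close>\<close>
      have "Q (Suc n) x = ((norm (s n x))\<^sup>2 - Q n (s n x)) + Q n (x - s n x)"
        using sym[of "s n x" x] unfolding QS
        by (simp add: Q_def bounded_clinear_simps[OF lin] cinner_distribs cinner_self)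
      then show ?thesis
        using Q by (simp add: add_nonneg_nonneg)
    qed
    moreover have "Q (Suc n) x \<le> (norm x)\<^sup>2" for x
      using Q(2)[of x] unfolding QS by (smt (verit) zero_le_power2)
    moreover have "b (s (Suc n) x) = s (Suc n) (b x)" for x
      by (simp add: sSuc bounded_clinear_simps[OF b(1)] cm)
    ultimately show ?case
      by blast
  qed
  have sym: "cinner (s n x) y = cinner x (s n y)" and cm: "b (s n x) = s n (b x)"
    and Qnn: "0 \<le> Q n x" for n x y
    using s by blast+
  have step: "Q n x - Q (Suc n) x = (norm (s n x))\<^sup>2" for n
    using sym[of n "s n x" x] by (simp add: Q_def sSuc cinner_distribs cinner_self)
  have telescope: "(\<Sum>k<n. (norm (s k x))\<^sup>2) = Q 0 x - Q n x" for n
    by (induction n) (simp_all flip: step)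
  have stepb: "cinner (b (s n x)) x - cinner (b (s (Suc n) x)) x = cinner (b (s n x)) (s n x)" for n
    by (simp add: sSuc bounded_clinear_simps[OF b(1)] cinner_distribs cm sym)
  have "cinner (b (a x)) x - cinner (b (s n x)) x = (\<Sum>k<n. cinner (b (s k x)) (s k x))" for n
    using sum_lessThan_telescope'[of "\<lambda>k. cinner (b (s k x)) x" n] by (simp only: s0 stepb)
  then have split: "cinner (b (a x)) x = (\<Sum>k<n. cinner (b (s k x)) (s k x)) + cinner (b (s n x)) x"
    for n
    by (simp only: diff_eq_eq)
  have "cmod (cinner (b (a x)) x) \<le> K * Q 0 x + K * norm x * norm (s n x)" for n
  proof -
    have le: "cmod (cinner (b u) v) \<le> K * norm u * norm v" for u v
      using norm_cinner_le[of "b u" v] mult_right_mono[OF b(2), of "norm v" u] by simp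
    have "cmod (cinner (b (a x)) x)
        \<le> (\<Sum>k<n. cmod (cinner (b (s k x)) (s k x))) + cmod (cinner (b (s n x)) x)"
      unfolding split[of n]
      by (intro norm_triangle_le add_right_mono norm_sum)
    also have "\<dots> \<le> (\<Sum>k<n. K * (norm (s k x))\<^sup>2) + K * norm (s n x) * norm x"
      using le by (intro add_mono sum_mono) (auto simp: power2_eq_square mult.assoc)
    also have "(\<Sum>k<n. K * (norm (s k x))\<^sup>2) = K * (Q 0 x - Q n x)"
      by (simp flip: sum_distrib_left telescope)
    also have "\<dots> \<le> K * Q 0 x"
    proof (cases "x = 0")
      case False
      have "0 \<le> K * norm x"
        using b(2)[of x] norm_ge_zero order_trans by blast
      then show ?thesis
        using Qnn False by (simp add: zero_le_mult_iff mult_left_mono)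
    qed (simp add: Q_def)
    finally show ?thesis
      by (simp add: mult_ac)
  qed
  moreover have "(\<lambda>n. K * Q 0 x + K * norm x * norm (s n x)) \<longlonglongrightarrow> K * Q 0 x + K * norm x * 0"
  proof -
    have "summable (\<lambda>k. (norm (s k x))\<^sup>2)"
      using Qnn by (intro summableI_nonneg_bounded[where x = "Q 0 x"]) (auto simp: telescope)
    then have "(\<lambda>k. sqrt ((norm (s k x))\<^sup>2)) \<longlonglongrightarrow> sqrt 0"
      by (intro tendsto_real_sqrt summable_LIMSEQ_zero)
    then show ?thesis
      by (intro tendsto_intros) simp
  qed
  ultimately have "cmod (cinner (b (a x)) x) \<le> K * Q 0 x + K * norm x * 0"
    by (intro LIMSEQ_le_const) auto
  then show ?thesis
    by (simp add: Q_def s0)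
qed

lemma cinner_commuting_positive_le:
  fixes a b :: "'h::complex_hilbert \<Rightarrow> 'h"
  assumes a: "positive_operator a"
    and b: "bounded_clinear b" "\<And>x. norm (b x) \<le> K * norm x"
    and comm: "\<And>x. b (a x) = a (b x)"
  shows "cmod (cinner (b (a x)) x) \<le> K * Re (cinner (a x) x)"
proof -
  have bdd: "bounded_clinear a"
    using a by (simp add: positive_operator_def)
  then obtain L where L: "0 \<le> L" "\<And>x. norm (a x) \<le> L * norm x"
    using bounded_clinear_bound by blast
  \<comment> \<open>Scaling makes \<open>a\<close> a contraction; \<open>L\<close> itself may be \<open>0\<close>.\<close>
  define c where "c = 1 / (L + 1)"
  have c: "0 < c" "c * L \<le> 1"
    using L(1) by (auto simp: c_def)
  let ?a = "\<lambda>x. complex_of_real c *\<^sub>C a x"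
  have Re: "Re (cinner (?a y) y) = c * Re (cinner (a y) y)" for y
    by (simp add: cinner_scaleC_left)
  have "cmod (cinner (b (?a x)) x) \<le> K * Re (cinner (?a x) x)"
  proof (rule cinner_commuting_contraction_le[OF _ _ b])
    show "positive_operator ?a"
      using a c by (simp add: positive_operator_def bounded_clinear_times cinner_scaleC_left)
    show "Re (cinner (?a y) y) \<le> (norm y)\<^sup>2" for y
    proof -
      have "Re (cinner (a y) y) \<le> norm (a y) * norm y"
        by (simp add: Re_cinner norm_cauchy_schwarz)
      also have "\<dots> \<le> L * norm y * norm y"
        by (rule mult_right_mono[OF L(2)]) simp
      finally have "c * Re (cinner (a y) y) \<le> (c * L) * (norm y)\<^sup>2"
        using c(1) by (simp add: power2_eq_square mult.assoc)
      also have "\<dots> \<le> (norm y)\<^sup>2"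
        using c(2) by (simp add: mult_left_le_one_le L(1) c(1) less_imp_le)
      finally show ?thesis
        by (simp only: Re)
    qed
    show "b (?a y) = ?a (b y)" for y
      by (simp add: bounded_clinear_simps[OF b(1)] comm)
  qed
  then have "c * cmod (cinner (b (a x)) x) \<le> c * (K * Re (cinner (a x) x))"
    using c(1) unfolding Re
    by (simp add: bounded_clinear_simps[OF b(1)] cinner_scaleC_left norm_mult mult_ac)
  then show ?thesis
    using c(1) by simp
qed

section \<open>Algebras of operators and bounded functionals\<close>

text \<open>Unital *-algebras of bounded operators. A von Neumann algebra and its commutant are
  examples.\<close>

locale operator_algebra =
  fixes M :: "('h::complex_hilbert \<Rightarrow> 'h) set"
  assumes bounded: "a \<in> M \<Longrightarrow> bounded_clinear a"
    and id_mem: "id \<in> M"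
    and comp_mem: "a \<in> M \<Longrightarrow> b \<in> M \<Longrightarrow> a \<circ> b \<in> M"
    and plus_mem: "a \<in> M \<Longrightarrow> b \<in> M \<Longrightarrow> (\<lambda>x. a x + b x) \<in> M"
    and times_mem: "a \<in> M \<Longrightarrow> (\<lambda>x. c *\<^sub>C a x) \<in> M"
    and cadjoint_mem: "a \<in> M \<Longrightarrow> cadjoint a \<in> M"
begin

lemma minus_mem: "a \<in> M \<Longrightarrow> b \<in> M \<Longrightarrow> (\<lambda>x. a x - b x) \<in> M"
  using plus_mem[of a "\<lambda>x. (- 1) *\<^sub>C b x"] times_mem[of b "- 1"] by (simp add: scaleC_minus_one)

end

lemma operator_algebra_commutant:
  assumes "\<And>a. a \<in> S \<Longrightarrow> bounded_clinear a" "\<And>a. a \<in> S \<Longrightarrow> cadjoint a \<in> S"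
  shows "operator_algebra (commutant S)"
proof
  fix a b :: "'a \<Rightarrow> 'a" and c
  assume a: "a \<in> commutant S"
  then show bdd: "bounded_clinear a"
    by (simp add: commutant_def)
  show "(\<lambda>x. c *\<^sub>C a x) \<in> commutant S"
    using a assms(1) by (auto simp: commutant_def bounded_clinear_times fun_eq_iff
        bounded_clinear_scaleC)
  have "cadjoint a (s x) = s (cadjoint a x)" if s: "s \<in> S" for s x
  proof (rule cinner_eqI)
    fix y
    have "cinner y (cadjoint a (s x)) = cinner (cadjoint s (a y)) x"
      using bdd assms(1)[OF s] by (simp add: cinner_cadjoint_left flip: cinner_cadjoint)
    also have "cadjoint s (a y) = a (cadjoint s y)"
      using a assms(2)[OF s] by (auto simp: commutant_def fun_eq_iff)
    also have "cinner (a (cadjoint s y)) x = cinner y (s (cadjoint a x))"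
      using bdd assms(1)[OF s] by (simp add: cinner_cadjoint_left cinner_cadjoint)
    finally show "cinner y (cadjoint a (s x)) = cinner y (s (cadjoint a x))" .
  qed
  then show "cadjoint a \<in> commutant S"
    using bdd by (auto simp: commutant_def fun_eq_iff bounded_clinear_cadjoint)
  assume b: "b \<in> commutant S"
  show "a \<circ> b \<in> commutant S"
    using a b by (auto simp: commutant_def bounded_clinear_comp fun_eq_iff)
  show "(\<lambda>x. a x + b x) \<in> commutant S"
    using a b assms(1) by (auto simp: commutant_def bounded_clinear_plus fun_eq_iff
        bounded_clinear_add)
next
  show "id \<in> commutant S"
    by (simp add: commutant_def bounded_clinear_id)
qed

lemma operator_algebra_vna:
  assumes "von_neumann_algebra M"
  shows "operator_algebra M"
proof -
  have M': "operator_algebra (commutant M)"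
    using assms by (intro operator_algebra_commutant) (auto simp: von_neumann_algebra_def)
  have "operator_algebra (commutant (commutant M))"
    using operator_algebra.bounded[OF M'] operator_algebra.cadjoint_mem[OF M']
    by (intro operator_algebra_commutant)
  then show ?thesis
    using assms by (simp add: von_neumann_algebra_def)
qed

text \<open>The bound arises from \<open>t\<^sup>2 = q / p\<close>; perturbing \<open>p\<close> and \<open>q\<close> by \<open>d > 0\<close> includes the
  cases \<open>p = 0\<close> and \<open>q = 0\<close>.\<close>

lemma le_geometric_mean:
  fixes p q C X :: real
  assumes le: "\<And>t. 0 < t \<Longrightarrow> X \<le> C * (t\<^sup>2 * p\<^sup>2 + q\<^sup>2 / t\<^sup>2)" and nn: "0 \<le> p" "0 \<le> q" "0 \<le> C"
  shows "X \<le> 2 * C * p * q"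
proof -
  have le_pert: "X \<le> 2 * C * (p + d) * (q + d)" if "0 < d" for d
  proof -
    define t where "t = sqrt ((q + d) / (p + d))"
    have t: "0 < t" "t\<^sup>2 = (q + d) / (p + d)"
      using nn that by (simp_all add: t_def add_nonneg_pos)
    have "t\<^sup>2 * p\<^sup>2 + q\<^sup>2 / t\<^sup>2 \<le> t\<^sup>2 * (p + d)\<^sup>2 + (q + d)\<^sup>2 / t\<^sup>2"
      using nn that by (intro add_mono mult_left_mono divide_right_mono power_mono) auto
    also have "\<dots> = 2 * (p + d) * (q + d)"
    proof -
      have "0 < p + d" "0 < q + d"
        using nn that by auto
      then show ?thesis
        unfolding t(2) by (simp add: power2_eq_square)
    qed
    finally have "C * (t\<^sup>2 * p\<^sup>2 + q\<^sup>2 / t\<^sup>2) \<le> C * (2 * (p + d) * (q + d))"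
      using nn(3) by (rule mult_left_mono)
    with le[OF t(1)] have "X \<le> C * (2 * (p + d) * (q + d))"
      by (rule order_trans)
    then show ?thesis
      by (simp add: mult_ac)
  qed
  have "((\<lambda>d. 2 * C * (p + d) * (q + d)) \<longlongrightarrow> 2 * C * (p + 0) * (q + 0)) (at_right 0)"
    by (intro tendsto_intros)
  moreover have "eventually (\<lambda>d. X \<le> 2 * C * (p + d) * (q + d)) (at_right 0)"
    using le_pert by (intro eventually_at_right_less[THEN eventually_mono])
  ultimately have "X \<le> 2 * C * (p + 0) * (q + 0)"
    by (intro tendsto_lowerbound) auto
  then show ?thesis
    by simp
qed

context operator_algebra
begin

text \<open>Polarisation: a functional bounded on squares \<open>a\<^sup>* a\<close> is bounded on products \<open>c\<^sup>* a\<close>. The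
  functional need not be positive, whence the factor 2.\<close>

lemma polarisation_bound:
  assumes add: "\<And>a b. a \<in> M \<Longrightarrow> b \<in> M \<Longrightarrow> \<phi> (\<lambda>x. a x + b x) = \<phi> a + \<phi> b"
    and scale: "\<And>c a. a \<in> M \<Longrightarrow> \<phi> (\<lambda>x. c *\<^sub>C a x) = c * \<phi> a"
    and bound: "\<And>a. a \<in> M \<Longrightarrow> cmod (\<phi> (cadjoint a \<circ> a)) \<le> C * (norm (a \<xi>))\<^sup>2"
    and C: "0 \<le> C" and mem: "a \<in> M" "c \<in> M"
  shows "cmod (\<phi> (cadjoint c \<circ> a)) \<le> 2 * C * norm (a \<xi>) * norm (c \<xi>)"
proof -
  define s where "s = (\<lambda>a c. \<phi> (cadjoint c \<circ> a))"
  have cadj: "cadjoint (\<lambda>x. l *\<^sub>C a x + k *\<^sub>C c x)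
      = (\<lambda>x. cnj l *\<^sub>C cadjoint a x + cnj k *\<^sub>C cadjoint c x)" if "a \<in> M" "c \<in> M" for l k a c
    using bounded that by (intro cadjoint_eqI) (simp add: cinner_distribs cinner_cadjoint)
  have expand: "s (\<lambda>x. l *\<^sub>C a x + k *\<^sub>C c x) (\<lambda>x. l *\<^sub>C a x + k *\<^sub>C c x)
      = cnj l * l * s a a + cnj k * l * s a c + cnj l * k * s c a + cnj k * k * s c c" for l k
  proof -
    note lin = bounded_clinear_simps[OF bounded[OF cadjoint_mem]]
    have *: "cadjoint (\<lambda>x. l *\<^sub>C a x + k *\<^sub>C c x) \<circ> (\<lambda>x. l *\<^sub>C a x + k *\<^sub>C c x)
      = (\<lambda>x. ((cnj l * l) *\<^sub>C (cadjoint a \<circ> a) x + (cnj k * l) *\<^sub>C (cadjoint c \<circ> a) x) +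
          ((cnj l * k) *\<^sub>C (cadjoint a \<circ> c) x + (cnj k * k) *\<^sub>C (cadjoint c \<circ> c) x))"
      using mem by (simp add: cadj fun_eq_iff lin scaleC_add_right scaleC_scaleC algebra_simps)
    show ?thesis
      unfolding s_def * using mem
      by (simp only: add scale plus_mem times_mem comp_mem cadjoint_mem) (simp add: comp_def)
  qed
  \<comment> \<open>Polarise \<open>s (t a) (t\<^sup>-\<^sup>1 c) = s a c\<close>; the parallelogram law evaluates the sum of the bounds.\<close>
  have "cmod (s a c) \<le> C * (t\<^sup>2 * (norm (a \<xi>))\<^sup>2 + (norm (c \<xi>))\<^sup>2 / t\<^sup>2)" if t: "0 < t" for t
  proof -
    define f where "f = (\<lambda>k. s (\<lambda>x. of_real t *\<^sub>C a x + (k / of_real t) *\<^sub>C c x)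
                               (\<lambda>x. of_real t *\<^sub>C a x + (k / of_real t) *\<^sub>C c x))"
    define g where "g = (\<lambda>k. (norm (of_real t *\<^sub>C a \<xi> + (k / of_real t) *\<^sub>C c \<xi>))\<^sup>2)"
    have fg: "cmod (f k) \<le> C * g k" for k
      using bound[of "\<lambda>x. of_real t *\<^sub>C a x + (k / of_real t) *\<^sub>C c x"] mem
      by (simp add: f_def g_def s_def plus_mem times_mem)
    have "4 * s a c = f 1 - f (- 1) + \<i> * f \<i> - \<i> * f (- \<i>)"
      using t unfolding f_def expand by (simp add: field_simps)
    then have "4 * cmod (s a c) = cmod (f 1 - f (- 1) + \<i> * f \<i> - \<i> * f (- \<i>))"
      by (metis norm_mult norm_numeral)
    also have "\<dots> \<le> cmod (f 1) + cmod (f (- 1)) + cmod (f \<i>) + cmod (f (- \<i>))"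
      using norm_triangle_ineq4[of "f 1" "f (- 1)"]
        norm_triangle_ineq[of "f 1 - f (- 1)" "\<i> * f \<i>"]
        norm_triangle_ineq4[of "f 1 - f (- 1) + \<i> * f \<i>" "\<i> * f (- \<i>)"]
      by (simp add: norm_mult)
    also have "\<dots> \<le> C * (g 1 + g (- 1) + g \<i> + g (- \<i>))"
      using fg[of 1] fg[of "- 1"] fg[of \<i>] fg[of "- \<i>"] by (simp add: distrib_left)
    also have "g 1 + g (- 1) + g \<i> + g (- \<i>) = 4 * (t\<^sup>2 * (norm (a \<xi>))\<^sup>2 + (norm (c \<xi>))\<^sup>2 / t\<^sup>2)"
    proof -
      have gk: "g k = Re (cinner (of_real t *\<^sub>C a \<xi> + (k / of_real t) *\<^sub>C c \<xi>)
          (of_real t *\<^sub>C a \<xi> + (k / of_real t) *\<^sub>C c \<xi>))" for k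
        unfolding g_def cinner_self by simp
      show ?thesis
        using t unfolding gk cinner_distribs cinner_self[of "a \<xi>"] cinner_self[of "c \<xi>"]
        by (simp add: power2_eq_square field_simps)
    qed
    finally have "4 * cmod (s a c) \<le> 4 * (C * (t\<^sup>2 * (norm (a \<xi>))\<^sup>2 + (norm (c \<xi>))\<^sup>2 / t\<^sup>2))"
      by (simp only: mult.left_commute[of C 4])
    then show ?thesis
      by (simp only: mult_le_cancel_left_pos zero_less_numeral)
  qed
  then show ?thesis
    unfolding s_def by (rule le_geometric_mean) (use C in auto)
qed

end

text \<open>An algebra with a cyclic vector \<open>\<xi>\<close>, which is not required to be a unit vector.\<close>

locale cyclic_algebra = operator_algebra M
  for M :: "('h::complex_hilbert \<Rightarrow> 'h) set" +
  fixes \<xi> :: 'h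
  assumes cyclic: "cyclic_vector M \<xi>"
begin

lemma dense: "closure ((\<lambda>a. a \<xi>) ` M) = UNIV"
  using cyclic by (simp add: cyclic_vector_def)

lemma eq_of_cinner_eq: "(\<And>a. a \<in> M \<Longrightarrow> cinner (a \<xi>) u = cinner (a \<xi>) v) \<Longrightarrow> u = v"
  by (rule cinner_eq_of_dense[OF dense]) auto

lemma operator_eqI:
  assumes "bounded_clinear S" "bounded_clinear T" "\<And>a. a \<in> M \<Longrightarrow> S (a \<xi>) = T (a \<xi>)"
  shows "S = T"
  using assms by (intro bounded_clinear_eq_of_dense[OF _ _ dense]) auto

lemma commutant_eqI:
  assumes "s \<in> commutant M" "t \<in> commutant M"
    and "\<And>a. a \<in> M \<Longrightarrow> cinner (s (a \<xi>)) \<xi> = cinner (t (a \<xi>)) \<xi>"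
  shows "s = t"
proof (rule operator_eqI)
  show "bounded_clinear s" "bounded_clinear t"
    using assms by (auto simp: commutant_def)
  fix a assume a: "a \<in> M"
  have "cinner (s (a \<xi>)) (c \<xi>) = cinner (t (a \<xi>)) (c \<xi>)" if c: "c \<in> M" for c
  proof -
    have "cinner (s (a \<xi>)) (c \<xi>) = cinner (cadjoint c (s (a \<xi>))) \<xi>"
      "cinner (t (a \<xi>)) (c \<xi>) = cinner (cadjoint c (t (a \<xi>))) \<xi>"
      using bounded[OF c] by (simp_all add: cinner_cadjoint_left)
    moreover have "cadjoint c (s (a \<xi>)) = s ((cadjoint c \<circ> a) \<xi>)"
      "cadjoint c (t (a \<xi>)) = t ((cadjoint c \<circ> a) \<xi>)"
      using assms(1,2) cadjoint_mem[OF c] by (auto simp: commutant_def fun_eq_iff)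
    ultimately show ?thesis
      using assms(3)[of "cadjoint c \<circ> a"] a c by (simp only: comp_mem cadjoint_mem)
  qed
  then have "cinner (c \<xi>) (s (a \<xi>)) = cinner (c \<xi>) (t (a \<xi>))" if "c \<in> M" for c
    using that by (metis cinner_commute)
  then show "s (a \<xi>) = t (a \<xi>)"
    by (rule eq_of_cinner_eq)
qed

text \<open>Radon-Nikodym theorem for linear functionals that are bounded, in the sense of sesquilinear
  forms, by a vector state with cyclic vector: the density is an operator of the commutant.\<close>

lemma radon_nikodym_commutant:
  assumes add: "\<And>a b. a \<in> M \<Longrightarrow> b \<in> M \<Longrightarrow> \<phi> (\<lambda>x. a x + b x) = \<phi> a + \<phi> b"
    and scale: "\<And>c a. a \<in> M \<Longrightarrow> \<phi> (\<lambda>x. c *\<^sub>C a x) = c * \<phi> a"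
    and bound: "\<And>a c. a \<in> M \<Longrightarrow> c \<in> M \<Longrightarrow>
      cmod (\<phi> (cadjoint c \<circ> a)) \<le> K * norm (a \<xi>) * norm (c \<xi>)"
    and K: "0 \<le> K"
  shows "\<exists>t\<in>commutant M. \<forall>a\<in>M. cinner (t (a \<xi>)) \<xi> = \<phi> a"
proof -
  have "\<exists>z. \<forall>(y, r)\<in>(\<lambda>a. (a \<xi>, \<phi> a)) ` M. r = cinner y z"
  proof (rule riesz_relation)
    show "(x + y, r + s) \<in> (\<lambda>a. (a \<xi>, \<phi> a)) ` M"
      if "(x, r) \<in> (\<lambda>a. (a \<xi>, \<phi> a)) ` M" "(y, s) \<in> (\<lambda>a. (a \<xi>, \<phi> a)) ` M" for x y r s
      using that by (auto simp: image_iff add intro!: bexI[OF _ plus_mem])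
    show sc: "(c *\<^sub>C x, c * r) \<in> (\<lambda>a. (a \<xi>, \<phi> a)) ` M"
      if "(x, r) \<in> (\<lambda>a. (a \<xi>, \<phi> a)) ` M" for c x r
      using that by (auto simp: image_iff scale intro!: bexI[OF _ times_mem])
    show "(0, 0) \<in> (\<lambda>a. (a \<xi>, \<phi> a)) ` M"
      using sc[OF imageI[OF id_mem], of 0] by simp
    show "cmod r \<le> (K * norm \<xi>) * norm y" if "(y, r) \<in> (\<lambda>a. (a \<xi>, \<phi> a)) ` M" for y r
      using that bound[OF _ id_mem] by (auto simp: cadjoint_id mult_ac)
  qed
  then obtain z where z: "\<And>a. a \<in> M \<Longrightarrow> \<phi> a = cinner (a \<xi>) z"
    by auto
  \<comment> \<open>The adjoint of the density is \<open>a \<xi> \<mapsto> a z\<close>.\<close>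
  let ?G = "(\<lambda>a. (a \<xi>, a z)) ` M"
  have "\<exists>T. bounded_clinear T \<and> (\<forall>(x, u)\<in>?G. \<forall>h. cinner u h = cinner x (T h))"
  proof (rule adjoint_relation[OF _ _ _ _ K])
    show "(x + y, u + v) \<in> ?G" if "(x, u) \<in> ?G" "(y, v) \<in> ?G" for x y u v
      using that by (auto simp: image_iff intro!: bexI[OF _ plus_mem])
    show "(c *\<^sub>C x, c *\<^sub>C u) \<in> ?G" if "(x, u) \<in> ?G" for c x u
      using that by (auto simp: image_iff intro!: bexI[OF _ times_mem])
    show "closure (fst ` ?G) = UNIV"
      using dense by (simp add: image_image)
    show "norm u \<le> K * norm x" if xu: "(x, u) \<in> ?G" for x u
    proof -
      obtain a where a: "a \<in> M" "x = a \<xi>" "u = a z"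
        using xu by auto
      show ?thesis
      proof (rule norm_le_of_dense[OF dense])
        fix y assume "y \<in> (\<lambda>a. a \<xi>) ` M"
        then obtain c where c: "c \<in> M" "y = c \<xi>"
          by auto
        have "cinner y u = cinner ((cadjoint a \<circ> c) \<xi>) z"
          using a c bounded by (simp add: cinner_cadjoint_left)
        also have "\<dots> = \<phi> (cadjoint a \<circ> c)"
          using a c by (simp add: z comp_mem cadjoint_mem)
        finally show "cmod (cinner y u) \<le> K * norm x * norm y"
          using bound[OF c(1) a(1)] a c by (simp add: mult_ac)
      qed (use K in simp)
    qed
  qed
  then obtain t where t: "bounded_clinear t" "\<And>a h. a \<in> M \<Longrightarrow> cinner (a z) h = cinner (a \<xi>) (t h)"
    by auto
  have "t (m h) = m (t h)" if m: "m \<in> M" for m h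
  proof (rule eq_of_cinner_eq)
    fix a assume a: "a \<in> M"
    have "cinner (a \<xi>) (t (m h)) = cinner ((cadjoint m \<circ> a) z) h"
      using a bounded[OF m] by (simp add: cinner_cadjoint_left flip: t(2))
    also have "\<dots> = cinner ((cadjoint m \<circ> a) \<xi>) (t h)"
      using a m by (intro t(2) comp_mem cadjoint_mem)
    finally show "cinner (a \<xi>) (t (m h)) = cinner (a \<xi>) (m (t h))"
      using bounded[OF m] by (simp add: cinner_cadjoint_left)
  qed
  then have "t \<in> commutant M"
    using t(1) by (auto simp: commutant_def)
  moreover have "cinner (t (a \<xi>)) \<xi> = \<phi> a" if "a \<in> M" for a
    using t(2)[OF id_mem, of "a \<xi>"] z[OF that] by (metis cinner_commute id_apply)
  ultimately show ?thesis
    by blast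
qed

end

section \<open>Gradings and twisted commutants\<close>

lemma star_automorphism_id:
  assumes "star_automorphism M \<theta>" "id \<in> M"
  shows "\<theta> id = id"
proof -
  obtain e where e: "e \<in> M" "\<theta> e = id"
    using assms by (auto simp: star_automorphism_def bij_betw_def image_iff dest!: equalityD2)
  have "\<theta> (id \<circ> e) = \<theta> id \<circ> \<theta> e"
    using assms e(1) unfolding star_automorphism_def by blast
  then show ?thesis
    using e(2) by simp
qed

text \<open>An algebra with a cyclic vector, graded by \<open>\<theta>\<close>, whose vector state is even.\<close>

locale graded_cyclic_algebra = cyclic_algebra M \<xi>
  for M :: "('h::complex_hilbert \<Rightarrow> 'h) set" and \<xi> +
  fixes \<theta> :: "('h \<Rightarrow> 'h) \<Rightarrow> ('h \<Rightarrow> 'h)"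
  assumes grading: "Z2_grading M \<theta>" and even: "even_state M \<theta> \<xi>"
begin

lemma theta_mem: "a \<in> M \<Longrightarrow> \<theta> a \<in> M"
  and theta_theta: "a \<in> M \<Longrightarrow> \<theta> (\<theta> a) = a"
  and theta_comp: "a \<in> M \<Longrightarrow> b \<in> M \<Longrightarrow> \<theta> (a \<circ> b) = \<theta> a \<circ> \<theta> b"
  and theta_cadjoint: "a \<in> M \<Longrightarrow> \<theta> (cadjoint a) = cadjoint (\<theta> a)"
  and theta_plus: "a \<in> M \<Longrightarrow> b \<in> M \<Longrightarrow> \<theta> (\<lambda>x. a x + b x) = (\<lambda>x. \<theta> a x + \<theta> b x)"
  and theta_times: "a \<in> M \<Longrightarrow> \<theta> (\<lambda>x. c *\<^sub>C a x) = (\<lambda>x. c *\<^sub>C \<theta> a x)"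
  using grading
  by (auto simp: Z2_grading_def star_automorphism_def operator_linear_on_def bij_betw_def)

lemma theta_id: "\<theta> id = id"
  using grading star_automorphism_id[OF _ id_mem] unfolding Z2_grading_def by blast

text \<open>Since the state is even, \<open>a \<xi> \<mapsto> \<theta>(a) \<xi>\<close> is symmetric, and therefore isometric.\<close>

lemma cinner_theta:
  assumes "a \<in> M" "c \<in> M"
  shows "cinner (\<theta> a \<xi>) (c \<xi>) = cinner (a \<xi>) (\<theta> c \<xi>)"
proof -
  have m: "cadjoint (\<theta> c) \<circ> a \<in> M"
    using assms by (intro comp_mem cadjoint_mem theta_mem)
  have "cinner (\<theta> a \<xi>) (c \<xi>) = vector_state \<xi> (cadjoint c \<circ> \<theta> a)"
    using assms bounded by (simp add: vector_state_def cinner_cadjoint_left)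
  also have "cadjoint c \<circ> \<theta> a = \<theta> (cadjoint (\<theta> c) \<circ> a)"
    using assms by (simp add: theta_comp cadjoint_mem theta_mem theta_cadjoint theta_theta)
  also have "vector_state \<xi> \<dots> = vector_state \<xi> (cadjoint (\<theta> c) \<circ> a)"
    using even m by (simp add: even_state_def)
  also have "\<dots> = cinner (a \<xi>) (\<theta> c \<xi>)"
    using assms bounded[OF theta_mem] by (simp add: vector_state_def cinner_cadjoint_left)
  finally show ?thesis .
qed

lemma norm_theta: "a \<in> M \<Longrightarrow> norm (\<theta> a \<xi>) = norm (a \<xi>)"
  using cinner_theta[of a "\<theta> a"]
  by (simp only: theta_mem theta_theta cinner_self of_real_eq_iff power2_eq_iff_nonneg norm_ge_zero)

lemma ex_grading_unitary: "\<exists>\<Gamma>. selfadjoint_unitary \<Gamma> \<and> (\<forall>a\<in>M. \<Gamma> (a \<xi>) = \<theta> a \<xi>)"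
proof -
  let ?G = "(\<lambda>a. (a \<xi>, \<theta> a \<xi>)) ` M"
  have "\<exists>T. bounded_clinear T \<and> (\<forall>(x, u)\<in>?G. \<forall>h. cinner u h = cinner x (T h))"
  proof (rule adjoint_relation[where K = 1])
    show "(x + y, u + v) \<in> ?G" if "(x, u) \<in> ?G" "(y, v) \<in> ?G" for x y u v
      using that by (auto simp: image_iff theta_plus intro!: bexI[OF _ plus_mem])
    show "(c *\<^sub>C x, c *\<^sub>C u) \<in> ?G" if "(x, u) \<in> ?G" for c x u
      using that by (auto simp: image_iff theta_times intro!: bexI[OF _ times_mem])
    show "closure (fst ` ?G) = UNIV"
      using dense by (simp add: image_image)
  qed (auto simp: norm_theta)
  then obtain \<Gamma> where \<Gamma>: "bounded_clinear \<Gamma>"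
    "\<And>a h. a \<in> M \<Longrightarrow> cinner (\<theta> a \<xi>) h = cinner (a \<xi>) (\<Gamma> h)"
    by auto
  have act: "\<Gamma> (a \<xi>) = \<theta> a \<xi>" if "a \<in> M" for a
    using that by (intro eq_of_cinner_eq) (simp add: cinner_theta flip: \<Gamma>(2))
  have "cadjoint \<Gamma> = \<Gamma>"
  proof (rule operator_eqI)
    fix a assume a: "a \<in> M"
    show "cadjoint \<Gamma> (a \<xi>) = \<Gamma> (a \<xi>)"
      using a by (intro eq_of_cinner_eq)
        (simp add: act cinner_theta flip: cinner_cadjoint[OF \<Gamma>(1)])
  qed (use \<Gamma>(1) bounded_clinear_cadjoint in auto)
  moreover have "\<Gamma> \<circ> \<Gamma> = id"
    by (rule operator_eqI)
      (auto simp: \<Gamma>(1) bounded_clinear_comp bounded_clinear_id act theta_mem theta_theta)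
  ultimately show ?thesis
    using \<Gamma>(1) act by (auto simp: selfadjoint_unitary_def)
qed

text \<open>The self-adjoint unitary \<open>\<Gamma>\<close> with \<open>\<Gamma> a \<xi> = \<theta>(a) \<xi>\<close>.\<close>

definition \<Gamma> where "\<Gamma> = grading_unitary M \<theta> \<xi>"

lemma
  shows selfadjoint_unitary_Gamma: "selfadjoint_unitary \<Gamma>"
    and Gamma_act: "a \<in> M \<Longrightarrow> \<Gamma> (a \<xi>) = \<theta> a \<xi>"
proof -
  have "\<exists>!\<Gamma>. selfadjoint_unitary \<Gamma> \<and> (\<forall>a\<in>M. \<Gamma> (a \<xi>) = \<theta> a \<xi>)"
    using ex_grading_unitary operator_eqI unfolding selfadjoint_unitary_def by metis
  from theI'[OF this] show "selfadjoint_unitary \<Gamma>" "a \<in> M \<Longrightarrow> \<Gamma> (a \<xi>) = \<theta> a \<xi>"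
    by (auto simp: \<Gamma>_def grading_unitary_def)
qed

lemma bounded_Gamma: "bounded_clinear \<Gamma>"
  using selfadjoint_unitary_Gamma by (simp add: selfadjoint_unitary_def)

lemmas Gamma_simps = bounded_clinear_simps[OF bounded_Gamma]

lemma Gamma_Gamma [simp]: "\<Gamma> (\<Gamma> x) = x"
  using selfadjoint_unitary_Gamma by (metis comp_apply id_apply selfadjoint_unitary_def)

lemma cinner_Gamma: "cinner (\<Gamma> x) y = cinner x (\<Gamma> y)"
  using cinner_cadjoint[OF bounded_Gamma] selfadjoint_unitary_Gamma
  by (simp add: selfadjoint_unitary_def)

lemma Gamma_xi [simp]: "\<Gamma> \<xi> = \<xi>"
  using Gamma_act[OF id_mem] by (simp add: theta_id)

lemma Gamma_commutant:
  assumes "b \<in> commutant M"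
  shows "(\<lambda>x. \<Gamma> (b (\<Gamma> x))) \<in> commutant M"
proof -
  have b: "bounded_clinear b" "\<And>a x. a \<in> M \<Longrightarrow> a (b x) = b (a x)"
    using assms by (auto simp: commutant_def fun_eq_iff)
  \<comment> \<open>\<open>\<Gamma>\<close> implements \<open>\<theta>\<close>, so conjugation by \<open>\<Gamma>\<close> preserves the algebra, hence its commutant.\<close>
  have intertwine: "\<Gamma> (a (\<Gamma> x)) = \<theta> a x" if a: "a \<in> M" for a x
  proof -
    have "\<Gamma> \<circ> a \<circ> \<Gamma> = \<theta> a"
      using a bounded[OF theta_mem[OF a]] bounded[OF a]
      by (intro operator_eqI) (auto simp: bounded_Gamma bounded_clinear_comp Gamma_act
          theta_mem theta_comp theta_theta Gamma_act[OF comp_mem[OF a theta_mem], simplified])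
    then show ?thesis
      by (metis comp_apply)
  qed
  have "a (\<Gamma> (b (\<Gamma> x))) = \<Gamma> (b (\<Gamma> (a x)))" if a: "a \<in> M" for a x
  proof -
    have "a (\<Gamma> (b (\<Gamma> x))) = \<Gamma> (\<theta> a (b (\<Gamma> x)))"
      using intertwine[OF theta_mem[OF a], of "\<Gamma> (b (\<Gamma> x))"] intertwine[OF a, of "b (\<Gamma> x)"]
      by (metis Gamma_Gamma)
    also have "\<dots> = \<Gamma> (b (\<theta> a (\<Gamma> x)))"
      using b(2)[OF theta_mem[OF a]] by simp
    also have "\<theta> a (\<Gamma> x) = \<Gamma> (a x)"
      using intertwine[OF a, of "\<Gamma> x"] by simp
    finally show ?thesis .
  qed
  moreover have "bounded_clinear (\<lambda>x. \<Gamma> (b (\<Gamma> x)))"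
    using bounded_clinear_comp[OF bounded_Gamma bounded_clinear_comp[OF b(1) bounded_Gamma]]
    by (simp add: comp_def)
  ultimately show ?thesis
    by (auto simp: commutant_def)
qed

sublocale commutant: operator_algebra "commutant M"
  by (intro operator_algebra_commutant bounded cadjoint_mem)

lemma
  assumes "b \<in> commutant M"
  shows even_part_commutant: "even_part \<Gamma> b \<in> commutant M"
    and odd_part_commutant: "odd_part \<Gamma> b \<in> commutant M"
  using commutant.times_mem[of _ "of_real (1/2)",
      OF commutant.plus_mem[OF assms Gamma_commutant[OF assms]]]
    commutant.times_mem[of _ "of_real (1/2)",
      OF commutant.minus_mem[OF assms Gamma_commutant[OF assms]]]
  unfolding even_part_def odd_part_def by (simp_all only: scaleC_of_real)

lemma twisted_commutant_eq: "twisted_commutant M \<theta> \<xi> = twist \<Gamma> ` commutant M"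
  by (simp add: twisted_commutant_def \<Gamma>_def)

lemma
  shows parts_add: "even_part \<Gamma> b x + odd_part \<Gamma> b x = b x"
    and even_part_Gamma: "even_part \<Gamma> b (\<Gamma> x) = \<Gamma> (even_part \<Gamma> b x)"
    and odd_part_Gamma: "odd_part \<Gamma> b (\<Gamma> x) = - \<Gamma> (odd_part \<Gamma> b x)"
  by (simp_all add: even_part_def odd_part_def Gamma_simps scaleR_add_right scaleR_diff_right
      add.commute flip: scaleR_add_left)

lemma twist_eqI:
  assumes "\<And>x. b x = p x + q x" "\<And>x. p (\<Gamma> x) = \<Gamma> (p x)" "\<And>x. q (\<Gamma> x) = - \<Gamma> (q x)"
  shows "twist \<Gamma> b = (\<lambda>x. p x + \<Gamma> (q x))"
proof -
  have "p = even_part \<Gamma> b \<and> q = odd_part \<Gamma> b"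
    using assms even_odd_part_unique[OF selfadjoint_unitary_Gamma, of b p q]
    by (auto simp: fun_eq_iff Gamma_simps)
  then show ?thesis
    by (simp add: twist_def)
qed

text \<open>Twisting changes an odd operator \<open>q\<close> to \<open>\<Gamma> q\<close>, which is again odd; hence twisting
  is an involution.\<close>

lemma twist_twist [simp]: "twist \<Gamma> (twist \<Gamma> b) = b"
proof -
  have "twist \<Gamma> (twist \<Gamma> b) = (\<lambda>x. even_part \<Gamma> b x + \<Gamma> (\<Gamma> (odd_part \<Gamma> b x)))"
    by (rule twist_eqI) (simp_all add: twist_def even_part_Gamma odd_part_Gamma Gamma_simps)
  then show ?thesis
    by (simp add: parts_add)
qed

lemma twist_plus: "twist \<Gamma> (\<lambda>x. b x + c x) = (\<lambda>x. twist \<Gamma> b x + twist \<Gamma> c x)"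
  by (simp add: fun_eq_iff twist_def even_part_def odd_part_def Gamma_simps algebra_simps)

lemma twist_times: "twist \<Gamma> (\<lambda>x. c *\<^sub>C b x) = (\<lambda>x. c *\<^sub>C twist \<Gamma> b x)"
  by (simp add: fun_eq_iff twist_def even_part_def odd_part_def Gamma_simps scaleC_add_right
      scaleC_diff_right scaleC_scaleC mult.commute flip: scaleC_of_real)

lemma twist_id: "twist \<Gamma> id = id"
  by (simp add: fun_eq_iff twist_def even_part_def odd_part_def Gamma_simps flip: scaleR_2)

text \<open>The twist is invisible to the state, since \<open>\<Gamma> \<xi> = \<xi>\<close>.\<close>

lemma cinner_twist: "cinner (twist \<Gamma> b x) \<xi> = cinner (b x) \<xi>"
  by (simp add: twist_def cinner_add_left cinner_Gamma flip: parts_add[of b x])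

lemma bounded_twist:
  assumes "b \<in> commutant M"
  shows "bounded_clinear (twist \<Gamma> b)"
  using bounded_clinear_plus[OF commutant.bounded[OF even_part_commutant[OF assms]]
      bounded_clinear_comp[OF bounded_Gamma commutant.bounded[OF odd_part_commutant[OF assms]]]]
  by (simp add: twist_def)

text \<open>The twisted commutant contains \<open>w\<^sup>* w\<close> for each of its elements \<open>w = p + \<Gamma> q\<close>, with \<open>p\<close> even and
  \<open>q\<close> odd: as \<open>\<Gamma>\<close> commutes with \<open>p\<close> and anticommutes with \<open>q\<close>, this product is
  \<open>(p\<^sup>* p + q\<^sup>* q) + \<Gamma> (p\<^sup>* q - q\<^sup>* p)\<close>, the twist of a sum of an even and an odd operator.\<close>

lemma twist_cadjoint_comp:
  assumes b: "b \<in> commutant M"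
  shows "cadjoint (twist \<Gamma> b) \<circ> twist \<Gamma> b \<in> twist \<Gamma> ` commutant M"
proof -
  define p q where "p = even_part \<Gamma> b" and "q = odd_part \<Gamma> b"
  have pq: "p \<in> commutant M" "q \<in> commutant M"
    using b by (simp_all add: p_def q_def even_part_commutant odd_part_commutant)
  then have lin: "bounded_clinear p" "bounded_clinear q"
    by (simp_all add: commutant.bounded)
  note lin' = lin[THEN bounded_clinear_cadjoint]
  have p\<Gamma>: "p (\<Gamma> x) = \<Gamma> (p x)" and q\<Gamma>: "q (\<Gamma> x) = - \<Gamma> (q x)" for x
    by (simp_all add: p_def q_def even_part_Gamma odd_part_Gamma)
  have p'\<Gamma>: "cadjoint p (\<Gamma> x) = \<Gamma> (cadjoint p x)" for x
    by (rule cinner_eqI) (simp add: p\<Gamma> flip: cinner_cadjoint[OF lin(1)] cinner_Gamma)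
  have q'\<Gamma>: "cadjoint q (\<Gamma> x) = - \<Gamma> (cadjoint q x)" for x
    by (rule cinner_eqI)
      (simp add: q\<Gamma> cinner_minus_left cinner_minus_right flip: cinner_cadjoint[OF lin(2)] cinner_Gamma)
  have adj: "cadjoint (twist \<Gamma> b) = (\<lambda>x. cadjoint p x - \<Gamma> (cadjoint q x))"
    using cinner_cadjoint[OF lin(1)] cinner_cadjoint[OF lin(2)] q'\<Gamma>
    by (intro cadjoint_eqI)
      (simp add: twist_def cinner_distribs cinner_Gamma flip: p_def q_def)
  define e where "e = (\<lambda>x. cadjoint p (p x) + cadjoint q (q x))"
  define f where "f = (\<lambda>x. cadjoint p (q x) - cadjoint q (p x))"
  note cl = commutant.comp_mem[OF commutant.cadjoint_mem, unfolded comp_def]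
  have ef: "(\<lambda>x. e x + f x) \<in> commutant M"
    unfolding e_def f_def by (intro commutant.plus_mem commutant.minus_mem cl pq)
  have "twist \<Gamma> (\<lambda>x. e x + f x) = (\<lambda>x. e x + \<Gamma> (f x))"
    by (rule twist_eqI) (simp_all add: e_def f_def p\<Gamma> q\<Gamma> p'\<Gamma> q'\<Gamma> Gamma_simps
        bounded_clinear_simps[OF lin'(1)] bounded_clinear_simps[OF lin'(2)])
  also have "\<dots> = cadjoint (twist \<Gamma> b) \<circ> twist \<Gamma> b"
    unfolding adj by (simp add: twist_def fun_eq_iff e_def f_def p'\<Gamma> q'\<Gamma> Gamma_simps
        bounded_clinear_simps[OF lin'(1)] bounded_clinear_simps[OF lin'(2)] flip: p_def q_def)
  finally show ?thesis
    using ef by (metis imageI)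
qed

text \<open>The vector \<open>\<xi>\<close>, being cyclic for the algebra, separates the twisted commutant, because
  \<open>twist \<Gamma> b \<xi> = \<Gamma> b \<Gamma> \<xi>\<close>.\<close>

lemma twist_separating:
  assumes b: "b \<in> commutant M" and zero: "twist \<Gamma> b \<xi> = 0"
  shows "b = (\<lambda>_. 0)"
proof -
  let ?c = "\<lambda>x. \<Gamma> (b (\<Gamma> x))"
  have c: "?c \<in> commutant M"
    using b by (rule Gamma_commutant)
  have "?c \<xi> = twist \<Gamma> b \<xi>"
    using odd_part_Gamma[of b \<xi>] even_part_Gamma[of b \<xi>]
    by (simp add: twist_def Gamma_simps flip: parts_add[of b \<xi>])
  have "?c = (\<lambda>_. 0)"
  proof (rule operator_eqI)
    show "bounded_clinear ?c"
      using c by (rule commutant.bounded)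
    show "bounded_clinear (\<lambda>_. 0)"
      by (simp add: bounded_clinear_def)
    fix a assume a: "a \<in> M"
    have "?c (a \<xi>) = a (?c \<xi>)"
      using a c by (auto simp: commutant_def fun_eq_iff)
    also have "\<dots> = 0"
      using \<open>?c \<xi> = twist \<Gamma> b \<xi>\<close> zero bounded_clinear_zero[OF bounded[OF a]] by simp
    finally show "?c (a \<xi>) = 0" .
  qed
  then have "b x = \<Gamma> 0" for x
    by (metis Gamma_Gamma)
  then show ?thesis
    by (simp add: Gamma_simps fun_eq_iff)
qed

end

section \<open>The dual map\<close>

lemma vector_state_cadjoint_comp:
  "bounded_clinear a \<Longrightarrow> vector_state \<xi> (cadjoint a \<circ> a) = of_real ((norm (a \<xi>))\<^sup>2)"
  by (simp add: vector_state_def cinner_cadjoint_left cinner_self)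

text \<open>The untwisted dual map. If \<open>\<parallel>b\<parallel> \<le> K\<close>, then \<open>\<phi>(a) = \<langle>b \<Psi>(a) \<eta>, \<eta>\<rangle>\<close> satisfies
  \<open>\<bar>\<phi>(a\<^sup>* a)\<bar> \<le> K \<langle>\<Psi>(a\<^sup>* a) \<eta>, \<eta>\<rangle> = K \<parallel>a \<xi>\<parallel>\<^sup>2\<close>, because \<open>\<Psi>(a\<^sup>* a)\<close> is positive and commutes
  with \<open>b\<close>.\<close>

lemma ex_dual_operator:
  fixes M :: "('h::complex_hilbert \<Rightarrow> 'h) set" and N :: "('k::complex_hilbert \<Rightarrow> 'k) set"
  assumes M: "cyclic_algebra M \<xi>" and \<Psi>: "\<Psi> \<in> M \<rightarrow> N" "operator_linear_on M \<Psi>" "positive_on M \<Psi>"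
    and state: "\<forall>a\<in>M. vector_state \<eta> (\<Psi> a) = vector_state \<xi> a"
    and b: "b \<in> commutant N"
  shows "\<exists>t\<in>commutant M. \<forall>a\<in>M. cinner (t (a \<xi>)) \<xi> = cinner (b (\<Psi> a \<eta>)) \<eta>"
proof -
  interpret cyclic_algebra M \<xi>
    by (rule M)
  have bdd: "bounded_clinear b"
    using b by (simp add: commutant_def)
  have comm: "b (\<Psi> a x) = \<Psi> a (b x)" if "a \<in> M" for a x
  proof -
    have "\<Psi> a \<circ> b = b \<circ> \<Psi> a"
      using b \<Psi>(1) that unfolding commutant_def by blast
    from fun_cong[OF this, of x] show ?thesis
      by simp
  qed
  obtain K where K: "0 \<le> K" "\<And>x. norm (b x) \<le> K * norm x"
    using bounded_clinear_bound[OF bdd] by blast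
  define \<phi> where "\<phi> = (\<lambda>a. cinner (b (\<Psi> a \<eta>)) \<eta>)"
  have add: "\<phi> (\<lambda>x. a x + c x) = \<phi> a + \<phi> c" if "a \<in> M" "c \<in> M" for a c
  proof -
    have "\<Psi> (\<lambda>x. a x + c x) = (\<lambda>y. \<Psi> a y + \<Psi> c y)"
      using \<Psi>(2) that unfolding operator_linear_on_def by blast
    then show ?thesis
      by (simp add: \<phi>_def bounded_clinear_add[OF bdd] cinner_add_left)
  qed
  have scale: "\<phi> (\<lambda>x. c *\<^sub>C a x) = c * \<phi> a" if "a \<in> M" for c a
  proof -
    have "\<Psi> (\<lambda>x. c *\<^sub>C a x) = (\<lambda>y. c *\<^sub>C \<Psi> a y)"
      using \<Psi>(2) that unfolding operator_linear_on_def by blast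
    then show ?thesis
      by (simp add: \<phi>_def bounded_clinear_scaleC[OF bdd] cinner_scaleC_left)
  qed
  have sq: "cmod (\<phi> (cadjoint a \<circ> a)) \<le> K * (norm (a \<xi>))\<^sup>2" if a: "a \<in> M" for a
  proof -
    have m: "cadjoint a \<circ> a \<in> M"
      using a by (intro comp_mem cadjoint_mem)
    have "positive_operator (\<Psi> (cadjoint a \<circ> a))"
      using \<Psi>(3) m positive_operator_cadjoint_comp[OF bounded[OF a]]
      by (simp add: positive_on_def)
    then have "cmod (\<phi> (cadjoint a \<circ> a)) \<le> K * Re (cinner (\<Psi> (cadjoint a \<circ> a) \<eta>) \<eta>)"
      unfolding \<phi>_def using bdd K(2) comm[OF m] by (rule cinner_commuting_positive_le)
    also have "cinner (\<Psi> (cadjoint a \<circ> a) \<eta>) \<eta> = of_real ((norm (a \<xi>))\<^sup>2)"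
      using bspec[OF state m] vector_state_cadjoint_comp[OF bounded[OF a], of \<xi>]
      by (simp only: vector_state_def[of \<eta>])
    finally show ?thesis
      by (simp add: comp_def)
  qed
  have "\<exists>t\<in>commutant M. \<forall>a\<in>M. cinner (t (a \<xi>)) \<xi> = \<phi> a"
  proof (rule radon_nikodym_commutant)
    show "cmod (\<phi> (cadjoint c \<circ> a)) \<le> (2 * K) * norm (a \<xi>) * norm (c \<xi>)"
      if "a \<in> M" "c \<in> M" for a c
      by (rule polarisation_bound[OF add scale sq K(1) that])
  qed (fact add, fact scale, use K(1) in simp)
  then show ?thesis
    by (simp only: \<phi>_def)
qed

theorem proposition11p1:
  fixes M :: "('h::complex_hilbert \<Rightarrow> 'h) set"
    and N :: "('k::complex_hilbert \<Rightarrow> 'k) set"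
    and \<theta>\<^sub>\<mu> :: "('h \<Rightarrow> 'h) \<Rightarrow> ('h \<Rightarrow> 'h)" and \<theta>\<^sub>\<nu> :: "('k \<Rightarrow> 'k) \<Rightarrow> ('k \<Rightarrow> 'k)"
    and \<xi>\<^sub>\<mu> :: 'h and \<xi>\<^sub>\<nu> :: 'k
    and \<Psi> :: "('h \<Rightarrow> 'h) \<Rightarrow> ('k \<Rightarrow> 'k)"
  assumes "von_neumann_algebra M" and "von_neumann_algebra N"
    and "Z2_grading M \<theta>\<^sub>\<mu>" and "Z2_grading N \<theta>\<^sub>\<nu>"
    and "cyclic_vector M \<xi>\<^sub>\<mu>" and "cyclic_vector N \<xi>\<^sub>\<nu>"
    and "norm \<xi>\<^sub>\<mu> = 1" and "norm \<xi>\<^sub>\<nu> = 1"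
    and "even_state M \<theta>\<^sub>\<mu> \<xi>\<^sub>\<mu>" and "even_state N \<theta>\<^sub>\<nu> \<xi>\<^sub>\<nu>"
    and "\<Psi> \<in> M \<rightarrow> N" and "operator_linear_on M \<Psi>" and "positive_on M \<Psi>"
    and "\<forall>a\<in>M. vector_state \<xi>\<^sub>\<nu> (\<Psi> a) = vector_state \<xi>\<^sub>\<mu> a"
  shows "(\<exists>!\<Phi>. twisted_dual_map M \<theta>\<^sub>\<mu> \<xi>\<^sub>\<mu> N \<theta>\<^sub>\<nu> \<xi>\<^sub>\<nu> \<Psi> \<Phi>) \<and>
    (\<forall>\<Phi>. twisted_dual_map M \<theta>\<^sub>\<mu> \<xi>\<^sub>\<mu> N \<theta>\<^sub>\<nu> \<xi>\<^sub>\<nu> \<Psi> \<Phi> \<longrightarrow>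
      operator_linear_on (twisted_commutant N \<theta>\<^sub>\<nu> \<xi>\<^sub>\<nu>) \<Phi> \<and>
      (\<Psi> id = id \<longrightarrow>
        (\<forall>b\<in>twisted_commutant N \<theta>\<^sub>\<nu> \<xi>\<^sub>\<nu>. vector_state \<xi>\<^sub>\<mu> (\<Phi> b) = vector_state \<xi>\<^sub>\<nu> b) \<and>
        faithful_on (twisted_commutant N \<theta>\<^sub>\<nu> \<xi>\<^sub>\<nu>) \<Phi>))"
proof -
  interpret M: graded_cyclic_algebra M \<xi>\<^sub>\<mu> \<theta>\<^sub>\<mu>
    using assms by (simp add: graded_cyclic_algebra_def graded_cyclic_algebra_axioms_def
        cyclic_algebra_def cyclic_algebra_axioms_def operator_algebra_vna)
  interpret N: graded_cyclic_algebra N \<xi>\<^sub>\<nu> \<theta>\<^sub>\<nu>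
    using assms by (simp add: graded_cyclic_algebra_def graded_cyclic_algebra_axioms_def
        cyclic_algebra_def cyclic_algebra_axioms_def operator_algebra_vna)
  let ?M' = "twisted_commutant M \<theta>\<^sub>\<mu> \<xi>\<^sub>\<mu>" and ?N' = "twisted_commutant N \<theta>\<^sub>\<nu> \<xi>\<^sub>\<nu>"
  let ?dual = "twisted_dual_map M \<theta>\<^sub>\<mu> \<xi>\<^sub>\<mu> N \<theta>\<^sub>\<nu> \<xi>\<^sub>\<nu> \<Psi>"
  note dual_def = twisted_dual_map_def
  \<comment> \<open>An operator of the twisted commutant is determined by its matrix elements
    \<open>\<langle>s a \<xi>\<^sub>\<mu>, \<xi>\<^sub>\<mu>\<rangle>\<close>; this gives uniqueness, linearity and preservation of the unit.\<close>
  have eqI: "s = t" if st: "s \<in> ?M'" "t \<in> ?M'"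
      and eq: "\<And>a. a \<in> M \<Longrightarrow> cinner (s (a \<xi>\<^sub>\<mu>)) \<xi>\<^sub>\<mu> = cinner (t (a \<xi>\<^sub>\<mu>)) \<xi>\<^sub>\<mu>" for s t
  proof -
    obtain s' t' where s't': "s' \<in> commutant M" "t' \<in> commutant M"
      "s = twist M.\<Gamma> s'" "t = twist M.\<Gamma> t'"
      using st by (auto simp: M.twisted_commutant_eq)
    then have "s' = t'"
      using eq by (intro M.commutant_eqI) (auto simp: M.cinner_twist)
    then show ?thesis
      using s't' by simp
  qed
  have ex: "\<exists>t\<in>?M'. \<forall>a\<in>M. cinner (t (a \<xi>\<^sub>\<mu>)) \<xi>\<^sub>\<mu> = cinner (b (\<Psi> a \<xi>\<^sub>\<nu>)) \<xi>\<^sub>\<nu>" if b: "b \<in> ?N'" for b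
  proof -
    obtain b' where b': "b' \<in> commutant N" "b = twist N.\<Gamma> b'"
      using b by (auto simp: N.twisted_commutant_eq)
    obtain t where "t \<in> commutant M"
      "\<And>a. a \<in> M \<Longrightarrow> cinner (t (a \<xi>\<^sub>\<mu>)) \<xi>\<^sub>\<mu> = cinner (b' (\<Psi> a \<xi>\<^sub>\<nu>)) \<xi>\<^sub>\<nu>"
      using ex_dual_operator[OF M.cyclic_algebra_axioms assms(11-14) b'(1)] by blast
    then show ?thesis
      unfolding M.twisted_commutant_eq b'(2)
      by (intro bexI[of _ "twist M.\<Gamma> t"]) (auto simp: M.cinner_twist N.cinner_twist)
  qed
  have idM: "id \<in> ?M'" and idN: "id \<in> ?N'"
    unfolding M.twisted_commutant_eq N.twisted_commutant_eq
    using M.twist_id N.twist_id M.commutant.id_mem N.commutant.id_mem by (metis imageI)+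
  have "\<exists>\<Phi>. ?dual \<Phi>"
  proof -
    define t where "t = (\<lambda>b. SOME t. t \<in> ?M' \<and>
      (\<forall>a\<in>M. cinner (t (a \<xi>\<^sub>\<mu>)) \<xi>\<^sub>\<mu> = cinner (b (\<Psi> a \<xi>\<^sub>\<nu>)) \<xi>\<^sub>\<nu>))"
    have "t b \<in> ?M' \<and>
      (\<forall>a\<in>M. cinner (t b (a \<xi>\<^sub>\<mu>)) \<xi>\<^sub>\<mu> = cinner (b (\<Psi> a \<xi>\<^sub>\<nu>)) \<xi>\<^sub>\<nu>)" if "b \<in> ?N'" for b
      using ex[OF that] unfolding t_def Bex_def by (rule someI_ex)
    then have t: "\<And>b. b \<in> ?N' \<Longrightarrow> t b \<in> ?M'"
      "\<And>b a. b \<in> ?N' \<Longrightarrow> a \<in> M \<Longrightarrow> cinner (t b (a \<xi>\<^sub>\<mu>)) \<xi>\<^sub>\<mu> = cinner (b (\<Psi> a \<xi>\<^sub>\<nu>)) \<xi>\<^sub>\<nu>"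
      by blast+
    have "t id = id"
      using assms(14) t(2)[OF idN] by (intro eqI t(1) idM idN) (simp add: vector_state_def)
    then have "?dual (restrict t ?N')"
      using t idN by (auto simp: dual_def)
    then show ?thesis
      by blast
  qed
  moreover have "\<Phi> = \<Phi>'" if "?dual \<Phi>" "?dual \<Phi>'" for \<Phi> \<Phi>'
  proof (rule PiE_ext)
    show \<Phi>: "\<Phi> \<in> ?N' \<rightarrow>\<^sub>E ?M'" and \<Phi>': "\<Phi>' \<in> ?N' \<rightarrow>\<^sub>E ?M'"
      using that by (simp_all add: dual_def)
    show "\<Phi> b = \<Phi>' b" if b: "b \<in> ?N'" for b
      using \<open>?dual \<Phi>\<close> \<open>?dual \<Phi>'\<close> b
      by (intro eqI PiE_mem[OF \<Phi>] PiE_mem[OF \<Phi>']) (auto simp: dual_def)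
  qed
  ultimately have ex1: "\<exists>!\<Phi>. ?dual \<Phi>"
    by blast
  have plusN: "(\<lambda>x. b x + c x) \<in> ?N'" if "b \<in> ?N'" "c \<in> ?N'" for b c
    using that unfolding N.twisted_commutant_eq
    by (auto simp: image_iff N.twist_plus intro!: bexI[OF _ N.commutant.plus_mem])
  have timesN: "(\<lambda>x. k *\<^sub>C b x) \<in> ?N'" if "b \<in> ?N'" for b k
    using that unfolding N.twisted_commutant_eq
    by (auto simp: image_iff N.twist_times intro!: bexI[OF _ N.commutant.times_mem])
  have plusM: "(\<lambda>x. b x + c x) \<in> ?M'" if "b \<in> ?M'" "c \<in> ?M'" for b c
    using that unfolding M.twisted_commutant_eq
    by (auto simp: image_iff M.twist_plus intro!: bexI[OF _ M.commutant.plus_mem])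
  have timesM: "(\<lambda>x. k *\<^sub>C b x) \<in> ?M'" if "b \<in> ?M'" for b k
    using that unfolding M.twisted_commutant_eq
    by (auto simp: image_iff M.twist_times intro!: bexI[OF _ M.commutant.times_mem])
  have linear: "operator_linear_on ?N' \<Phi>" if "?dual \<Phi>" for \<Phi>
  proof -
    have mem: "\<Phi> b \<in> ?M'" if "b \<in> ?N'" for b
      using \<open>?dual \<Phi>\<close> that by (auto simp: dual_def)
    have val: "cinner (\<Phi> b (a \<xi>\<^sub>\<mu>)) \<xi>\<^sub>\<mu> = cinner (b (\<Psi> a \<xi>\<^sub>\<nu>)) \<xi>\<^sub>\<nu>" if "b \<in> ?N'" "a \<in> M" for a b
      using \<open>?dual \<Phi>\<close> that by (simp add: dual_def)
    have "\<Phi> (\<lambda>x. b x + c x) = (\<lambda>y. \<Phi> b y + \<Phi> c y)" if "b \<in> ?N'" "c \<in> ?N'" for b c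
      using that by (intro eqI mem plusN plusM) (simp_all add: val plusN cinner_add_left)
    moreover have "\<Phi> (\<lambda>x. k *\<^sub>C b x) = (\<lambda>y. k *\<^sub>C \<Phi> b y)" if "b \<in> ?N'" for k b
      using that by (intro eqI mem timesN timesM) (simp_all add: val timesN cinner_scaleC_left)
    ultimately show ?thesis
      by (simp add: operator_linear_on_def)
  qed
  have state: "vector_state \<xi>\<^sub>\<mu> (\<Phi> b) = vector_state \<xi>\<^sub>\<nu> b"
    if "?dual \<Phi>" "\<Psi> id = id" "b \<in> ?N'" for \<Phi> b
  proof -
    have "cinner (\<Phi> b (id \<xi>\<^sub>\<mu>)) \<xi>\<^sub>\<mu> = cinner (b (\<Psi> id \<xi>\<^sub>\<nu>)) \<xi>\<^sub>\<nu>"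
      using that M.id_mem unfolding dual_def by blast
    then show ?thesis
      using that(2) by (simp add: vector_state_def)
  qed
  have "faithful_on ?N' \<Phi>" if \<Phi>: "?dual \<Phi>" "\<Psi> id = id" for \<Phi>
    unfolding faithful_on_def
  proof (intro ballI impI)
    fix b assume b: "b \<in> ?N'" and zero: "\<Phi> (cadjoint b \<circ> b) = (\<lambda>_. 0)"
    obtain b' where b': "b' \<in> commutant N" "b = twist N.\<Gamma> b'"
      using b by (auto simp: N.twisted_commutant_eq)
    have "cadjoint b \<circ> b \<in> ?N'"
      using N.twist_cadjoint_comp[OF b'(1)] by (simp add: b'(2) N.twisted_commutant_eq)
    from state[OF \<Phi> this] have "vector_state \<xi>\<^sub>\<nu> (cadjoint b \<circ> b) = 0"
      by (simp add: zero vector_state_def)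
    moreover have "bounded_clinear b"
      using N.bounded_twist[OF b'(1)] b'(2) by simp
    ultimately have "b \<xi>\<^sub>\<nu> = 0"
      by (simp add: vector_state_cadjoint_comp)
    then have "b' = (\<lambda>_. 0)"
      using N.twist_separating[OF b'(1)] by (simp add: b'(2))
    then show "b = (\<lambda>_. 0)"
      by (simp add: b'(2) twist_def even_part_def odd_part_def N.Gamma_simps)
  qed
  then show ?thesis
    using ex1 linear state by blast
qed

end
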